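(* There is $q\in L^2(\mathbb{R})$ such that $\mathrm{M}_w(\xi,q)=+\infty$ for every $\xi\in[\tfrac12,1]$.
   Context: For complex-valued $q\in L^1(\mathbb{R})$ consider the Dirac operator $\mathcal{L}_q=i\sigma_3\partial_x+i(q\sigma_--\overline{q}\sigma_+)$ with $\sigma_3=\begin{pmatrix}1&0\\0&-1\end{pmatrix}$, $\sigma_+=\begin{pmatrix}0&1\\0&0\end{pmatrix}$, $\sigma_-=\begin{pmatrix}0&0\\1&0\end{pmatrix}$. Let $E(x,\xi)=\mathrm{diag}(e^{\frac{\xi}{2i}x},e^{-\frac{\xi}{2i}x})$. For $\xi\in\mathbb{R}$ the Jost solutions $T_\pm(x,\xi,q)$ are the $2\times2$ matrix solutions of $\mathcal{L}_qT_\pm=\tfrac{\xi}{2}T_\pm$ with $T_\pm=E(x,\xi)+o(1)$ as $x\to\pm\infty$. They satisfy $T_-(x,\xi,q)=T_+(x,\xi,q)T(\xi,q)$ with an $x$-independent matrix $$T(\xi,q)=\begin{pmatrix}a(\xi,q)&\overline{b(\xi,q)}\\ b(\xi,q)&\overline{a(\xi,q)}\end{pmatrix},\qquad |a|^2-|b|^2=1,$$ which defines $a(\xi,q)$ and $b(\xi,q)$. The function $a(\cdot,q)$ is the boundary value on $\mathbb{R}$ of the outer function $$a(k,q)=\exp\Bigl(\frac1{\pi i}\int_{\mathbb{R}}\frac{\log|a(s,q)|}{s-k}\,ds\Bigr),\qquad k\in\mathbb{C}^+=\{\operatorname{Im}k>0\},$$ and $\arg a(k,q)$ denotes the imaginary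 part of the exponent (the branch of $\log a$ vanishing at infinity) for $k\in\mathbb{C}^+$, extended continuously to real $k$ (for compactly supported integrable potentials $a$ is continuous with $|a|\ge1$ on $\overline{\mathbb{C}^+}$). For $q\in L^2(\mathbb{R})$ and $\xi\in\mathbb{R}$, $$\mathrm{M}_w(\xi,q)=\sup_{T_1<T_2}|\arg a(\xi,q\cdot\chi_{T_1\le x\le T_2})|,$$ where the supremum is over real $T_1<T_2$ and $\chi$ denotes a characteristic function. *)

theory Defs
  imports "HOL-Analysis.Analysis"
begin

definition L2_real :: "(real \<Rightarrow> complex) \<Rightarrow> bool" where
  "L2_real q \<longleftrightarrow>
     q \<in> borel_measurable lebesgue \<and> integrable lebesgue (\<lambda>x. (norm (q x))\<^sup>2)"

definition truncation :: "(real \<Rightarrow> complex) \<Rightarrow> real \<Rightarrow> real \<Rightarrow> real \<Rightarrow> complex" where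
  "truncation q T1 T2 = (\<lambda>x. q x * indicator {T1..T2} x)"

definition sigma3 :: "complex^2^2" where
  "sigma3 = vector [vector [1, 0], vector [0, -1]]"

definition sigma_plus :: "complex^2^2" where
  "sigma_plus = vector [vector [0, 1], vector [0, 0]]"

definition sigma_minus :: "complex^2^2" where
  "sigma_minus = vector [vector [0, 0], vector [1, 0]]"

definition mscale :: "complex \<Rightarrow> complex^2^2 \<Rightarrow> complex^2^2" where
  "mscale c A = (\<chi> i j. c * A $ i $ j)"

text \<open>\<open>T\<close> is locally absolutely continuous with a.e. derivative \<open>T'\<close>, i.e. \<open>T\<close> is an
  antiderivative of the locally integrable function \<open>T'\<close>. As \<open>q\<close> is merely integrable, this is
  the sense in which solutions are differentiable.\<close>

definition loc_abs_cont_deriv :: "(real \<Rightarrow> complex^2^2) \<Rightarrow> (real \<Rightarrow> complex^2^2) \<Rightarrow> bool" where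
  "loc_abs_cont_deriv T T' \<longleftrightarrow>
     (\<forall>x y. x \<le> y \<longrightarrow> T' absolutely_integrable_on {x..y} \<and> T y - T x = integral {x..y} T')"

text \<open>The value at a point of \<open>\<L>\<^sub>q T\<close>; the derivative of \<open>T\<close> is passed as a separate argument
  because it exists only almost everywhere.\<close>

definition dirac_op ::
    "(real \<Rightarrow> complex) \<Rightarrow> (real \<Rightarrow> complex^2^2) \<Rightarrow> (real \<Rightarrow> complex^2^2) \<Rightarrow> real \<Rightarrow> complex^2^2" where
  "dirac_op q T T' x =
     mscale \<i> (sigma3 ** T' x)
     + mscale \<i> ((mscale (q x) sigma_minus - mscale (cnj (q x)) sigma_plus) ** T x)"

definition dirac_solution :: "(real \<Rightarrow> complex) \<Rightarrow> real \<Rightarrow> (real \<Rightarrow> complex^2^2) \<Rightarrow> bool" where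
  "dirac_solution q \<xi> T \<longleftrightarrow>
     (\<exists>T'. loc_abs_cont_deriv T T' \<and>
        (AE x in lebesgue. dirac_op q T T' x = mscale (of_real \<xi> / 2) (T x)))"

definition free_solution :: "real \<Rightarrow> real \<Rightarrow> complex^2^2" where
  "free_solution x \<xi> =
     vector [vector [exp (of_real \<xi> / (2 * \<i>) * of_real x), 0],
             vector [0, exp (- (of_real \<xi> / (2 * \<i>)) * of_real x)]]"

definition jost_plus :: "(real \<Rightarrow> complex) \<Rightarrow> real \<Rightarrow> (real \<Rightarrow> complex^2^2) \<Rightarrow> bool" where
  "jost_plus q \<xi> T \<longleftrightarrow>
     dirac_solution q \<xi> T \<and> ((\<lambda>x. T x - free_solution x \<xi>) \<longlongrightarrow> 0) at_top"

definition jost_minus :: "(real \<Rightarrow> complex) \<Rightarrow> real \<Rightarrow> (real \<Rightarrow> complex^2^2) \<Rightarrow> bool" where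
  "jost_minus q \<xi> T \<longleftrightarrow>
     dirac_solution q \<xi> T \<and> ((\<lambda>x. T x - free_solution x \<xi>) \<longlongrightarrow> 0) at_bot"

text \<open>Meaningful for integrable \<open>q\<close>, when both Jost solutions exist and are unique.\<close>

definition scattering_matrix :: "(real \<Rightarrow> complex) \<Rightarrow> real \<Rightarrow> complex^2^2" where
  "scattering_matrix q \<xi> =
     (THE M. \<exists>Tp Tm. jost_plus q \<xi> Tp \<and> jost_minus q \<xi> Tm \<and> (\<forall>x. Tm x = Tp x ** M))"

definition coeff_a :: "real \<Rightarrow> (real \<Rightarrow> complex) \<Rightarrow> complex" where
  "coeff_a \<xi> q = scattering_matrix q \<xi> $ 1 $ 1"

text \<open>The exponent of the outer function \<open>a(k, q)\<close>, for \<open>Im k > 0\<close>.\<close>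

definition log_a :: "complex \<Rightarrow> (real \<Rightarrow> complex) \<Rightarrow> complex" where
  "log_a k q =
     1 / (of_real pi * \<i>) *
     (LINT s|lebesgue. of_real (ln (norm (coeff_a s q))) / (of_real s - k))"

text \<open>The continuous extension of \<open>arg a(k, q) = Im (log_a k q)\<close> from the open upper half-plane
  to the real point \<open>\<xi>\<close>.\<close>

definition arg_a :: "real \<Rightarrow> (real \<Rightarrow> complex) \<Rightarrow> real" where
  "arg_a \<xi> q = Lim (at (of_real \<xi>) within {k. Im k > 0}) (\<lambda>k. Im (log_a k q))"

definition M_w :: "real \<Rightarrow> (real \<Rightarrow> complex) \<Rightarrow> ereal" where
  "M_w \<xi> q =
     (SUP (T1, T2) \<in> {(T1, T2). T1 < T2}. ereal \<bar>arg_a \<xi> (truncation q T1 T2)\<bar>)"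

end

theory Submission
  imports Defs "HOL-Complex_Analysis.Cauchy_Integral_Formula"
begin

text \<open>The potential is a chain of linear chirps with disjoint supports. The \<open>n\<close>-th chirp has
  modulus \<open>h\<close>, length \<open>S\<close> with \<open>h\<^sup>2 S = 2^-n\<close>, and a local frequency sweeping linearly from
  \<open>0\<close> to \<open>1\<close>. Fix \<open>\<xi>\<close> and cut the chirp just before its local frequency reaches \<open>\<xi>\<close>, at
  distance \<open>4h\<close>. With \<open>\<Delta>\<close> the detuning, the phase of \<open>a\<close> accumulates at rate about
  \<open>h\<^sup>2 / \<Delta>\<close> (a second-order adiabatic frequency shift), which integrates to about
  \<open>h\<^sup>2 S ln (\<xi> / 4h)\<close>; this exceeds \<open>n\<close> once
  \<open>ln (1 / h)\<close> is of order \<open>n 2^n\<close>.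

  That this accumulated phase is the argument of the outer function follows from Cauchy's formula in
  the upper half plane: the reflection coefficient \<open>\<rho>\<close> solves a Riccati equation and stays in the
  unit disc, so \<open>a = exp F\<close> with \<open>F\<close> the integral of \<open>cnj q * \<rho>\<close>, and \<open>F\<close> is holomorphic,
  continuous up to the real line and \<open>O(1/|k|)\<close>.\<close>

section \<open>Calculus lemmas\<close>

text \<open>The obstacle is size: a chirp has small L2 norm, but its L1 norm
  \<open>h S = 2^-n / h\<close> is huge, so no expansion in powers of \<open>q\<close> controls the
  solution along it. The bound on the reflection coefficient is therefore non-perturbative. In the
  frame rotating with the chirp, the system depends on time only through the detuning \<Delta>, and
  the quadratic energy that would be conserved for frozen \<Delta> changes monotonically. Stopping
  at \<Delta> = 4h turns this into |\<rho>| <= 1/2, and the nonlinear correction to the rate h^2 /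
  \<Delta> then costs at most a quarter of it. The cut stays on one side of resonance, where the
  rate has one sign, and affects only the argument of the logarithm.

  The cut depends on \<xi>, the potential does not: this is where the supremum over windows enters.
  Each window lies inside one block, so different chirps never interact.

  The other obstacle is the definition of the argument through ln |a| on the line, which does not
  see the equation. A logarithm followed continuously in \<open>t\<close> could differ from the
  outer branch; its decay in \<open>k\<close> makes the two agree.\<close>

lemma has_vector_derivative_norm_bound:
  fixes f :: "real \<Rightarrow> 'a::banach"
  assumes "a \<le> b" "\<And>t. t \<in> {a..b} \<Longrightarrow> (f has_vector_derivative f' t) (at t within {a..b})"
    "\<And>t. t \<in> {a..b} \<Longrightarrow> norm (f' t) \<le> B"
  shows "norm (f b - f a) \<le> B * (b - a)"
proof -
  have "0 \<le> B" using order_trans[OF norm_ge_zero assms(3)[of a]] assms(1) by simp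
  moreover have "(f' has_integral (f b - f a)) (cbox a b)"
    using fundamental_theorem_of_calculus[OF assms(1,2)] by simp
  ultimately have "norm (f b - f a) \<le> B * measure lborel (cbox a b)"
    by (rule has_integral_bound) (use assms(3) in auto)
  then show ?thesis using assms(1) by simp
qed

lemma has_vector_derivative_nonneg_le:
  fixes f :: "real \<Rightarrow> real"
  assumes "a \<le> b" "\<And>t. t \<in> {a..b} \<Longrightarrow> (f has_vector_derivative f' t) (at t within {a..b})"
    "\<And>t. t \<in> {a..b} \<Longrightarrow> 0 \<le> f' t"
  shows "f a \<le> f b"
  using has_integral_nonneg[OF fundamental_theorem_of_calculus[OF assms(1,2)] assms(3)] by simp

lemma has_vector_derivative_Re:
  "(f has_vector_derivative f') F \<Longrightarrow> ((\<lambda>t. Re (f t)) has_vector_derivative Re f') F"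
  by (rule bounded_linear.has_vector_derivative[OF bounded_linear_Re])

lemma has_vector_derivative_Im:
  "(f has_vector_derivative f') F \<Longrightarrow> ((\<lambda>t. Im (f t)) has_vector_derivative Im f') F"
  by (rule bounded_linear.has_vector_derivative[OF bounded_linear_Im])

lemma has_vector_derivative_exp:
  fixes f :: "real \<Rightarrow> complex"
  assumes "(f has_vector_derivative f') (at t within S)"
  shows "((\<lambda>t. exp (f t)) has_vector_derivative f' * exp (f t)) (at t within S)"
  using field_vector_diff_chain_within[OF assms has_field_derivative_at_within[OF DERIV_exp]]
  by (simp add: o_def)

lemma has_vector_derivative_quotient:
  fixes f g :: "real \<Rightarrow> complex"
  assumes "(f has_vector_derivative f') (at t within S)" "(g has_vector_derivative g') (at t within S)" "g t \<noteq> 0"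
  shows "((\<lambda>t. f t / g t) has_vector_derivative (f' * g t - f t * g') / (g t * g t)) (at t within S)"
proof -
  have "((\<lambda>t. f t / g t) has_derivative (\<lambda>h. (h *\<^sub>R f' * g t - f t * (h *\<^sub>R g')) / (g t * g t))) (at t within S)"
    using assms unfolding has_vector_derivative_def by (intro has_derivative_divide')
  moreover have "(h *\<^sub>R f' * g t - f t * (h *\<^sub>R g')) / (g t * g t) = h *\<^sub>R ((f' * g t - f t * g') / (g t * g t))" for h
    by (simp add: scaleR_conv_of_real algebra_simps)
  ultimately show ?thesis unfolding has_vector_derivative_def by simp
qed

text \<open>Continuity keeps \<open>F w\<close> within distance 1 < pi of \<open>F z\<close> for
  \<open>w\<close> near \<open>z\<close>, so the principal logarithm of
  \<open>exp (F w) / exp (F z)\<close> recovers \<open>F w - F z\<close> exactly. This avoids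
  differentiating an integral over a Riccati solution with respect to \<open>k\<close>.\<close>

lemma holomorphic_on_continuous_log:
  fixes F :: "complex \<Rightarrow> complex"
  assumes S: "open S" and F: "continuous_on S F" and exp: "(\<lambda>z. exp (F z)) holomorphic_on S"
  shows "F holomorphic_on S"
  unfolding holomorphic_on_open[OF S]
proof
  fix z assume z: "z \<in> S"
  have "isCont F z" using F S z by (simp add: continuous_on_eq_continuous_at)
  then obtain d where d: "d > 0" "\<And>w. dist w z < d \<Longrightarrow> dist (F w) (F z) < 1"
    unfolding continuous_at_eps_delta by (metis zero_less_one)
  obtain e where e: "e > 0" "ball z e \<subseteq> S" using S z openE by blast
  let ?B = "ball z (min d e)"
  have eq: "F w = F z + Ln (exp (F w) / exp (F z))" if "w \<in> ?B" for w
  proof -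
    have "\<bar>Im (F w - F z)\<bar> < 1"
      using d(2)[of w] that abs_Im_le_cmod[of "F w - F z"] by (simp add: dist_norm norm_minus_commute)
    then have "\<bar>Im (F w - F z)\<bar> < pi" using pi_gt3 by linarith
    then have "Ln (exp (F w - F z)) = F w - F z" by (intro Ln_exp) auto
    then show ?thesis by (simp add: exp_diff)
  qed
  define E where "E = (\<lambda>z. exp (F z))"
  have "E z \<noteq> 0" by (simp add: E_def)
  obtain D where "(E has_field_derivative D) (at z)"
    using exp z unfolding holomorphic_on_open[OF S] E_def by blast
  then have "((\<lambda>w. F z + Ln (E w / E z)) has_field_derivative (D / E z)) (at z)"
    using \<open>E z \<noteq> 0\<close> by (auto intro!: derivative_eq_intros)
  then have "(F has_field_derivative (D / E z)) (at z)"
    by (rule has_field_derivative_transform_within_open[of _ _ _ ?B]) (use d e eq in \<open>auto simp: E_def\<close>)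
  then show "\<exists>f'. (F has_field_derivative f') (at z)" ..
qed

lemma has_vector_derivative_exp_linear:
  "((\<lambda>x. exp (c * complex_of_real x)) has_vector_derivative c * exp (c * of_real x)) (at x within S)"
proof (rule has_vector_derivative_exp)
  have "(complex_of_real has_vector_derivative of_real 1) (at x within S)"
    by (rule has_vector_derivative_of_real) (rule DERIV_ident)
  from has_vector_derivative_mult_right[OF this, of c]
  show "((\<lambda>t. c * complex_of_real t) has_vector_derivative c) (at x within S)" by simp
qed

text \<open>Continuity is local, so it suffices to work on balls; the Picard majorants are uniform
  only for bounded \<open>k\<close>.\<close>

lemma continuous_on_of_cballs:
  fixes f :: "complex \<times> real \<Rightarrow> complex"
  assumes "\<And>R. continuous_on (cball 0 R \<times> S) f"
  shows "continuous_on (UNIV \<times> S) f"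
  unfolding continuous_on_eq_continuous_within
proof safe
  fix k :: complex and t assume "t \<in> S"
  have "continuous (at (k, t) within cball 0 (norm k + 1) \<times> S) f"
    using assms \<open>t \<in> S\<close> by (auto simp: continuous_on_eq_continuous_within)
  also have "at (k, t) within cball 0 (norm k + 1) \<times> S = at (k, t) within UNIV \<times> S"
    by (rule at_within_nhd[of _ "ball 0 (norm k + 1) \<times> UNIV"]) (auto intro!: open_Times)
  finally show "continuous (at (k, t) within UNIV \<times> S) f" .
qed

text \<open>Supplies the majorant for ln |a| on the real line; the antiderivative arctan has finite
  limits at both ends.\<close>

lemma integrable_inverse_1_plus_square: "integrable lebesgue (\<lambda>s::real. 1 / (1 + s\<^sup>2))"
proof -
  have nz: "1 + s\<^sup>2 \<noteq> 0" for s :: real by (metis add_pos_nonneg less_numeral_extra(1,3) zero_le_power2)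
  have "set_integrable lborel (einterval (- \<infinity>) \<infinity>) (\<lambda>s. 1 / (1 + s\<^sup>2))"
  proof (rule interval_integral_FTC_nonneg(1)[where F = arctan and A = "- (pi / 2)" and B = "pi / 2"])
    show "((arctan \<circ> real_of_ereal) \<longlongrightarrow> - (pi / 2)) (at_right (- \<infinity>))"
      unfolding ereal_tendsto_simps by (rule tendsto_arctan_at_bot)
    show "((arctan \<circ> real_of_ereal) \<longlongrightarrow> pi / 2) (at_left \<infinity>)"
      unfolding ereal_tendsto_simps by (rule tendsto_arctan_at_top)
    show "DERIV arctan s :> 1 / (1 + s\<^sup>2)" for s
      using DERIV_arctan[of s] by (simp add: divide_inverse)
    show "isCont (\<lambda>s. 1 / (1 + s\<^sup>2)) s" for s :: real
      using nz[of s] by (intro continuous_intros)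
  qed auto
  then have "integrable lborel (\<lambda>s::real. 1 / (1 + s\<^sup>2))"
    by (simp add: set_integrable_def einterval_def)
  then show ?thesis by (subst integrable_completion) auto
qed

section \<open>Outer functions in the upper half plane\<close>

lemma path_image_upper_arc:
  assumes "R > 0"
  shows "path_image (part_circlepath 0 R 0 pi) \<subseteq> {z. Im z \<ge> 0} \<inter> sphere 0 R"
  using assms path_image_part_circlepath_subset[of 0 pi R 0]
  by (auto simp: path_image_part_circlepath Im_exp sin_ge_zero simp flip: cis_conv_exp)

lemma path_image_lower_arc:
  assumes "R > 0"
  shows "path_image (part_circlepath 0 R pi (2 * pi)) \<subseteq> {z. Im z \<le> 0} \<inter> sphere 0 R"
proof -
  have "sin x \<le> 0" if "pi \<le> x" "x \<le> 2 * pi" for x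
    using sin_ge_zero[of "x - pi"] that by simp
  then show ?thesis
    using assms path_image_part_circlepath_subset[of pi "2 * pi" R 0]
    by (auto simp: path_image_part_circlepath mult_nonneg_nonpos simp flip: cis_conv_exp)
qed

lemma path_image_real_segment:
  "path_image (linepath (of_real a) (of_real b)) \<subseteq> {z. Im z = 0}"
  by (auto simp: closed_segment_def)

text \<open>The full circle winds once around \<open>z\<close>. Its lower half, closed up by the
  reversed diameter, stays in a convex half plane that misses \<open>z\<close> and so winds zero
  times; subtracting leaves the upper half disc.\<close>

lemma winding_number_semicircle:
  assumes "R > 0" "norm z < R" "Im z > 0"
  shows "winding_number (linepath (- of_real R) (of_real R) +++ part_circlepath 0 R 0 pi) z = 1"
proof -
  let ?up = "part_circlepath 0 R 0 pi" and ?lo = "part_circlepath 0 R pi (2 * pi)"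
  let ?line = "linepath (- of_real R) (of_real R :: complex)"
  have line: "z \<notin> path_image ?line" "path_image ?line \<subseteq> {z. Im z \<le> 0}"
    using path_image_real_segment[of "- R" R] assms by auto
  have arcs: "z \<notin> path_image ?up" "z \<notin> path_image ?lo"
    using path_image_upper_arc[OF assms(1)] path_image_lower_arc[OF assms(1)] assms by auto
  have circ: "z \<notin> path_image (circlepath 0 R)"
    using assms by (auto simp: sphere_def)
  have sub: "subpath 0 (1/2) (circlepath 0 R) = ?up" "subpath (1/2) 1 (circlepath 0 R) = ?lo"
    by (auto simp: subpath_def circlepath_def part_circlepath_def linepath_def algebra_simps fun_eq_iff)
  have "winding_number ?up z + winding_number ?lo z = winding_number (circlepath 0 R) z"
    using winding_number_subpath_combine[of "circlepath 0 R" z 0 "1/2" 1] circ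
    by (simp add: sub)
  also have "\<dots> = 1"
    using assms by (intro winding_number_circlepath) auto
  finally have "winding_number ?up z + winding_number ?lo z = 1" .
  moreover have "winding_number (?lo +++ reversepath ?line) z = 0"
  proof (rule winding_number_zero_outside)
    show "convex {z. Im z \<le> 0}" by (rule convex_halfspace_Im_le)
    show "path_image (?lo +++ reversepath ?line) \<subseteq> {z. Im z \<le> 0}"
      using path_image_lower_arc[OF assms(1)] line(2)
      by (intro subset_path_image_join) (auto simp del: reversepath_linepath path_image_linepath)
    show "path (?lo +++ reversepath ?line)" by (intro path_join_imp) (auto simp: exp_eq_polar)
  qed (use assms in \<open>auto simp: exp_eq_polar\<close>)
  moreover have "winding_number (?lo +++ reversepath ?line) z = winding_number ?lo z + winding_number (reversepath ?line) z"
    by (rule winding_number_join)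
       (use arcs line in \<open>auto simp del: reversepath_linepath path_image_linepath simp: exp_eq_polar\<close>)
  moreover have "winding_number (reversepath ?line) z = - winding_number ?line z"
    using line by (intro winding_number_reversepath) auto
  moreover have "winding_number (?line +++ ?up) z = winding_number ?line z + winding_number ?up z"
    using arcs line by (intro winding_number_join) auto
  ultimately show ?thesis by (simp add: algebra_simps)
qed

text \<open>Cauchy's formula on a half disc, for \<open>z\<close> on either side of the line because
  both \<open>z\<close> and \<open>cnj z\<close> occur later. The error is the arc: there |f| <=
  K/R, the denominator is at least R - |z|, and the length is pi R. The forms of Cauchy's theorem on
  convex sets are used because \<open>f\<close> is merely continuous along the diameter.\<close>

lemma half_plane_Cauchy:
  fixes f :: "complex \<Rightarrow> complex"
  assumes cont: "continuous_on {z. Im z \<ge> 0} f" and holo: "f holomorphic_on {z. Im z > 0}"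
    and decay: "\<And>z. Im z \<ge> 0 \<Longrightarrow> norm z * norm (f z) \<le> K"
    and R: "norm z < R" and z: "Im z \<noteq> 0"
  shows "norm (integral {-R..R} (\<lambda>s. f (of_real s) / (of_real s - z)) - (if Im z > 0 then 2 * pi * \<i> * f z else 0))
           \<le> K * pi / (R - norm z)"
proof -
  let ?up = "part_circlepath 0 R 0 pi" and ?line = "linepath (- of_real R) (of_real R :: complex)"
  let ?g = "\<lambda>w. f w / (w - z)"
  define v where "v = (if Im z > 0 then 2 * pi * \<i> * f z else 0)"
  have R0: "R > 0" using R norm_ge_zero[of z] by linarith
  have int: "interior {z. Im z \<ge> 0} = {z. Im z > 0}" 
    using interior_halfspace_ge[of "\<i>" 0] by (simp add: inner_complex_def)
  have fd: "f field_differentiable at w" if "Im w > 0" for w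
    using holo that open_halfspace_Im_gt by (auto simp: holomorphic_on_open field_differentiable_def)
  have up: "path_image ?up \<subseteq> {z. Im z \<ge> 0} \<inter> sphere 0 R" by (rule path_image_upper_arc[OF R0])
  have line: "path_image ?line \<subseteq> {z. Im z = 0}" using path_image_real_segment[of "- R" R] by simp
  have pi: "path_image (?line +++ ?up) \<subseteq> {z. Im z \<ge> 0} - {z}"
    using up line z R by (intro subset_path_image_join) auto
  have vp: "valid_path (?line +++ ?up)" by (intro valid_path_join) auto
  have loop: "pathfinish (?line +++ ?up) = pathstart (?line +++ ?up)" by (simp add: exp_eq_polar)
  have total: "(?g has_contour_integral v) (?line +++ ?up)"
  proof (cases "Im z > 0")
    case True
    have "(?g has_contour_integral (2 * pi * \<i> * winding_number (?line +++ ?up) z * f z)) (?line +++ ?up)"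
      by (rule Cauchy_integral_formula_weak[where k = "{}", OF convex_halfspace_Im_ge _ cont _ _ vp pi loop])
         (use True fd in \<open>auto simp: int\<close>)
    then show ?thesis using winding_number_semicircle[OF R0 R True] True by (simp add: v_def)
  next
    case False
    have "(?g has_contour_integral 0) (?line +++ ?up)"
    proof (rule Cauchy_theorem_convex[where K = "{}", OF _ convex_halfspace_Im_ge _ _ vp _ loop])
      show "continuous_on {z. Im z \<ge> 0} ?g" using False z by (intro continuous_intros cont) auto
      show "?g field_differentiable at w" if "w \<in> interior {z. Im z \<ge> 0} - {}" for w
        using that False z fd[of w] by (intro derivative_intros) (auto simp: int)
    qed (use pi in auto)
    then show ?thesis using False by (simp add: v_def)
  qed
  have cont_g: "continuous_on ({z. Im z \<ge> 0} - {z}) ?g"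
    by (intro continuous_intros continuous_on_subset[OF cont]) auto
  have "?g contour_integrable_on ?up"
    by (rule contour_integrable_continuous_part_circlepath, rule continuous_on_subset[OF cont_g])
       (use up R in auto)
  then obtain I2 where I2: "(?g has_contour_integral I2) ?up" unfolding contour_integrable_on_def by blast
  have "continuous_on (closed_segment (- of_real R) (of_real R)) ?g"
    by (rule continuous_on_subset[OF cont_g]) (use line z in auto)
  then have "?g contour_integrable_on ?line"
    by (rule contour_integrable_continuous_linepath)
  then obtain I1 where I1: "(?g has_contour_integral I1) ?line" unfolding contour_integrable_on_def by blast
  have "(?g has_contour_integral (I1 + I2)) (?line +++ ?up)"
    by (intro has_contour_integral_join I1 I2) auto
  then have sum: "I1 + I2 = v" by (rule has_contour_integral_unique[OF _ total])
  have "((\<lambda>s. ?g (of_real s)) has_integral I1) {-R..R}"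
    using I1 R0 by (subst (asm) has_contour_integral_linepath_Reals_iff) auto
  then have I1_eq: "integral {-R..R} (\<lambda>s. ?g (of_real s)) = I1" by (rule integral_unique)
  have "norm I2 \<le> K / R / (R - norm z) * R * (pi - 0)"
  proof (rule has_contour_integral_bound_part_circlepath[OF I2])
    \<comment> \<open>At the point 0 the decay hypothesis reads \<open>0 \<le> K\<close>.\<close>
    show "0 \<le> K / R / (R - norm z)"
      using decay[of 0] R R0 by (auto intro!: divide_nonneg_nonneg)
    fix w assume "w \<in> path_image ?up"
    then have w: "Im w \<ge> 0" "norm w = R" using up by auto
    have "norm (f w) \<le> K / R" using decay[OF w(1)] w(2) R0 by (simp add: field_simps)
    moreover have "R - norm z \<le> norm (w - z)" using w(2) norm_triangle_ineq2[of w z] by simp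
    ultimately show "norm (?g w) \<le> K / R / (R - norm z)"
      using R unfolding norm_divide by (intro frac_le) (auto intro: order_trans[OF norm_ge_zero])
  qed (use R0 in auto)
  also have "\<dots> = K * pi / (R - norm z)" using R0 by simp
  finally have "norm I2 \<le> K * pi / (R - norm z)" .
  moreover have "I1 - v = - I2" using sum by (simp add: algebra_simps eq_neg_iff_add_eq_0)
  ultimately have "norm (I1 - v) \<le> K * pi / (R - norm z)" by simp
  then show ?thesis unfolding I1_eq v_def .
qed

text \<open>On the line, \<open>Re f\<close> is the mean of \<open>f\<close> and its conjugate.
  Against \<open>1 / (s - z)\<close> the first contributes \<open>2 pi i f z\<close>. The second is
  the conjugate of the integral of \<open>f\<close> against \<open>1 / (s - cnj z)\<close>, which
  tends to 0 because \<open>cnj z\<close> lies below the line. Decay at infinity excludes an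
  additive imaginary constant.\<close>

lemma half_plane_outer_representation:
  fixes f :: "complex \<Rightarrow> complex"
  assumes cont: "continuous_on {z. Im z \<ge> 0} f" and holo: "f holomorphic_on {z. Im z > 0}"
    and decay: "\<And>z. Im z \<ge> 0 \<Longrightarrow> norm z * norm (f z) \<le> K"
    and int: "integrable lebesgue (\<lambda>s. Re (f (of_real s)))" and z: "Im z > 0"
  shows "1 / (of_real pi * \<i>) * (LINT s|lebesgue. of_real (Re (f (of_real s))) / (of_real s - z)) = f z"
proof -
  define g where "g = (\<lambda>s. of_real (Re (f (of_real s))) / (of_real s - z))"
  have dist: "Im z \<le> norm (of_real s - z)" for s
    using abs_Im_le_cmod[of "of_real s - z"] by simp
  have int_g: "integrable lebesgue g"
  proof (rule Bochner_Integration.integrable_bound)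
    show "integrable lebesgue (\<lambda>s. Re (f (of_real s)) / Im z)" using int by simp
    have "(\<lambda>s. 1 / (of_real s - z)) \<in> borel_measurable lborel"
      using z by (auto intro!: borel_measurable_continuous_onI continuous_intros)
    then have "(\<lambda>s. 1 / (of_real s - z)) \<in> borel_measurable lebesgue" by (rule measurable_completion)
    moreover have "(\<lambda>s. complex_of_real (Re (f (of_real s)))) \<in> borel_measurable lebesgue"
      using borel_measurable_integrable[OF int] by measurable
    ultimately have "(\<lambda>s. complex_of_real (Re (f (of_real s))) * (1 / (of_real s - z))) \<in> borel_measurable lebesgue"
      by (intro borel_measurable_times)
    then show "g \<in> borel_measurable lebesgue" by (simp add: g_def)
    show "AE s in lebesgue. norm (g s) \<le> norm (Re (f (of_real s)) / Im z)"
    proof (rule AE_I2)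
      fix s
      show "norm (g s) \<le> norm (Re (f (of_real s)) / Im z)"
        using dist[of s] z by (auto simp: g_def norm_divide intro!: divide_left_mono mult_pos_pos)
    qed
  qed
  have lim1: "(\<lambda>n. integral {- real n..real n} g) \<longlonglongrightarrow> (LINT s|lebesgue. g s)"
  proof -
    have "integral {- real n..real n} g = (LINT s|lebesgue. indicator {- real n..real n} s *\<^sub>R g s)" for n
    proof -
      have "set_integrable lebesgue {- real n..real n} g"
        unfolding set_integrable_def using int_g by (intro integrable_mult_indicator) auto
      from set_lebesgue_integral_eq_integral(2)[OF this] show ?thesis
        by (simp add: set_lebesgue_integral_def)
    qed
    moreover have "(\<lambda>n. LINT s|lebesgue. indicator {- real n..real n} s *\<^sub>R g s) \<longlonglongrightarrow> (LINT s|lebesgue. g s)"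
    proof (rule integral_dominated_convergence[where w = "\<lambda>s. norm (g s)"])
      show "AE s in lebesgue. (\<lambda>n. indicator {- real n..real n} s *\<^sub>R g s) \<longlonglongrightarrow> g s"
      proof (rule AE_I2)
        fix s :: real
        obtain N where "\<bar>s\<bar> \<le> real N" using real_arch_simple by blast
        then have "\<forall>\<^sub>F n in sequentially. indicator {- real n..real n} s *\<^sub>R g s = g s"
          by (intro eventually_sequentiallyI[of N]) (auto simp: indicator_def)
        then show "(\<lambda>n. indicator {- real n..real n} s *\<^sub>R g s) \<longlonglongrightarrow> g s"
          by (rule tendsto_eventually)
      qed
      show "integrable lebesgue (\<lambda>s. norm (g s))" using int_g by (rule integrable_norm)
      show "g \<in> borel_measurable lebesgue" using int_g by simp
      show "(\<lambda>s. indicator {- real n..real n} s *\<^sub>R g s) \<in> borel_measurable lebesgue" for n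
        using int_g by (intro borel_measurable_integrable integrable_mult_indicator) auto
    qed (auto simp: indicator_def)
    ultimately show ?thesis by simp
  qed
  have "(\<lambda>n. integral {- real n..real n} g) \<longlonglongrightarrow> pi * \<i> * f z"
  proof (rule LIM_zero_cancel, rule Lim_null_comparison)
    show "(\<lambda>n. K * pi / (real n - norm z)) \<longlonglongrightarrow> 0"
      by (rule real_tendsto_divide_at_top[OF tendsto_const])
         (simp add: filterlim_tendsto_add_at_top[of "\<lambda>_. - norm z", OF tendsto_const filterlim_real_sequentially, simplified])
    show "\<forall>\<^sub>F n in sequentially. norm (integral {- real n..real n} g - pi * \<i> * f z) \<le> K * pi / (real n - norm z)"
      using eventually_gt_at_top[of "nat \<lceil>norm z\<rceil>"]
    proof eventually_elim
      case (elim n)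
      then have n: "norm z < real n" by linarith
      let ?n = "real n"
      let ?f = "\<lambda>s. f (of_real s) / (of_real s - z)" and ?h = "\<lambda>s. f (of_real s) / (of_real s - cnj z)"
      have cf: "continuous_on {-?n..?n} (\<lambda>s. f (of_real s))"
        by (rule continuous_on_compose2[OF cont]) (auto intro!: continuous_intros)
      have ne: "of_real s \<noteq> z" "of_real s \<noteq> cnj z" for s
        using z by (auto simp: complex_eq_iff)
      have i: "?f integrable_on {-?n..?n}" "?h integrable_on {-?n..?n}"
        using ne by (auto intro!: integrable_continuous_real continuous_intros cf)
      have "integral {-?n..?n} g = integral {-?n..?n} (\<lambda>s. (?f s + cnj (?h s)) / 2)"
      proof (rule integral_cong)
        fix s
        have "?f s + cnj (?h s) = of_real (2 * Re (f (of_real s))) / (of_real s - z)"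
          using complex_add_cnj[of "f (of_real s)"] by (simp flip: add_divide_distrib)
        also have "\<dots> = 2 * g s" by (simp add: g_def)
        finally show "g s = (?f s + cnj (?h s)) / 2" by simp
      qed
      also have "\<dots> = (integral {-?n..?n} ?f + cnj (integral {-?n..?n} ?h)) / 2"
      proof -
        have "((\<lambda>s. (?f s + cnj (?h s)) / 2) has_integral
            (integral {-?n..?n} ?f + cnj (integral {-?n..?n} ?h)) / 2) {-?n..?n}"
          by (intro has_integral_divide has_integral_add integrable_integral[OF i(1)]
              has_integral_linear[OF integrable_integral[OF i(2)] bounded_linear_cnj, unfolded o_def])
        then show ?thesis by (rule integral_unique)
      qed
      finally have eq: "integral {-?n..?n} g - pi * \<i> * f z =
          ((integral {-?n..?n} ?f - 2 * pi * \<i> * f z) + cnj (integral {-?n..?n} ?h)) / 2"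
        by (simp add: field_simps)
      have b1: "norm (integral {-?n..?n} ?f - 2 * pi * \<i> * f z) \<le> K * pi / (?n - norm z)"
        using half_plane_Cauchy[OF cont holo decay n] z by simp
      have b2: "norm (cnj (integral {-?n..?n} ?h)) \<le> K * pi / (?n - norm z)"
        using half_plane_Cauchy[OF cont holo decay, of "cnj z" ?n] n z unfolding complex_mod_cnj by simp
      show ?case unfolding eq norm_divide
        using norm_triangle_mono[OF b1 b2] by (simp add: mult_ac)
    qed
  qed
  from LIMSEQ_unique[OF lim1 this] show ?thesis
    by (simp add: g_def)
qed

section \<open>The Zakharov--Shabat system\<close>

text \<open>Polynomials in \<open>k\<close> with coefficients continuous in \<open>t\<close>. The
  class is stable under multiplication by continuous coefficients and powers of \<open>k\<close> and
  under indefinite integration in \<open>t\<close>, hence contains the Picard iterates; joint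
  continuity and holomorphy in \<open>k\<close> then come without differentiating under an integral.
  \<open>cong\<close> allows arbitrary values outside the interval, where the integrals are not
  controlled.\<close>

inductive parampoly :: "real \<Rightarrow> real \<Rightarrow> (complex \<Rightarrow> real \<Rightarrow> complex) \<Rightarrow> bool" for \<alpha> \<beta> where
  monomial: "continuous_on {\<alpha>..\<beta>} p \<Longrightarrow> parampoly \<alpha> \<beta> (\<lambda>k t. p t * k ^ j)"
| add: "parampoly \<alpha> \<beta> f \<Longrightarrow> parampoly \<alpha> \<beta> g \<Longrightarrow> parampoly \<alpha> \<beta> (\<lambda>k t. f k t + g k t)"
| cong: "parampoly \<alpha> \<beta> f \<Longrightarrow> (\<And>k t. t \<in> {\<alpha>..\<beta>} \<Longrightarrow> g k t = f k t) \<Longrightarrow> parampoly \<alpha> \<beta> g"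

lemma parampoly_mult:
  assumes "parampoly \<alpha> \<beta> f" "continuous_on {\<alpha>..\<beta>} r"
  shows "parampoly \<alpha> \<beta> (\<lambda>k t. r t * k ^ n * f k t)"
  using assms(1)
proof induction
  case (monomial p j)
  have "parampoly \<alpha> \<beta> (\<lambda>k t. (r t * p t) * k ^ (n + j))"
    using assms(2) monomial by (intro parampoly.monomial continuous_intros)
  then show ?case
    by (rule parampoly.cong) (simp add: power_add mult_ac)
next
  case (add f g)
  then have "parampoly \<alpha> \<beta> (\<lambda>k t. r t * k ^ n * f k t + r t * k ^ n * g k t)"
    by (intro parampoly.add)
  then show ?case by (simp add: distrib_left)
next
  case (cong f g)
  show ?case by (rule parampoly.cong[OF cong.IH]) (use cong in auto)
qed

lemma parampoly_continuous:
  assumes "parampoly \<alpha> \<beta> f"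
  shows "continuous_on (UNIV \<times> {\<alpha>..\<beta>}) (\<lambda>(k, t). f k t)"
  using assms
proof induction
  case (monomial p j)
  have "continuous_on (UNIV \<times> {\<alpha>..\<beta>}) (\<lambda>z::complex \<times> real. p (snd z))"
    by (rule continuous_on_compose2[OF monomial]) (auto intro!: continuous_intros)
  then show ?case
    unfolding split_beta by (auto intro!: continuous_intros)
next
  case (add f g)
  then show ?case unfolding split_beta by (auto intro!: continuous_intros)
next
  case (cong f g)
  have "continuous_on (UNIV \<times> {\<alpha>..\<beta>}) (\<lambda>(k, t). g k t)
      \<longleftrightarrow> continuous_on (UNIV \<times> {\<alpha>..\<beta>}) (\<lambda>(k, t). f k t)"
    by (rule continuous_on_cong) (use cong.hyps in auto)
  with cong.IH show ?case by blast
qed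

lemma parampoly_continuous_snd:
  assumes "parampoly \<alpha> \<beta> f"
  shows "continuous_on {\<alpha>..\<beta>} (f k)"
proof -
  have "continuous_on {\<alpha>..\<beta>} (\<lambda>t. (\<lambda>(k, t). f k t) (k, t))"
    by (rule continuous_on_compose2[OF parampoly_continuous[OF assms]]) (auto intro!: continuous_intros)
  then show ?thesis by simp
qed

lemma parampoly_holomorphic:
  assumes "parampoly \<alpha> \<beta> f" "t \<in> {\<alpha>..\<beta>}"
  shows "(\<lambda>k. f k t) holomorphic_on UNIV"
  using assms
proof induction
  case (monomial p j)
  then show ?case by (auto intro!: holomorphic_intros)
next
  case (add f g)
  then show ?case by (auto intro!: holomorphic_intros)
next
  case (cong f g)
  then show ?case by simp
qed

lemma parampoly_integral:
  assumes "parampoly \<alpha> \<beta> f"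
  shows "parampoly \<alpha> \<beta> (\<lambda>k t. integral {\<alpha>..t} (f k))"
  using assms
proof induction
  case (monomial p j)
  have "parampoly \<alpha> \<beta> (\<lambda>k t. integral {\<alpha>..t} p * k ^ j)"
    by (intro parampoly.monomial indefinite_integral_continuous_1 integrable_continuous_real monomial)
  then show ?case by simp
next
  case (add f g)
  from add.IH have "parampoly \<alpha> \<beta> (\<lambda>k t. integral {\<alpha>..t} (f k) + integral {\<alpha>..t} (g k))"
    by (rule parampoly.add)
  then show ?case
  proof (rule parampoly.cong)
    fix k t assume "t \<in> {\<alpha>..\<beta>}"
    then have "continuous_on {\<alpha>..t} (f k)" "continuous_on {\<alpha>..t} (g k)"
      using add.hyps by (auto intro: continuous_on_subset[OF parampoly_continuous_snd])
    then show "integral {\<alpha>..t} (\<lambda>t. f k t + g k t) = integral {\<alpha>..t} (f k) + integral {\<alpha>..t} (g k)"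
      by (intro integral_add integrable_continuous_real)
  qed
next
  case (cong f g)
  show ?case
  proof (rule parampoly.cong[OF cong.IH])
    fix k t assume "t \<in> {\<alpha>..\<beta>}"
    then show "integral {\<alpha>..t} (g k) = integral {\<alpha>..t} (f k)"
      by (intro integral_cong) (use cong.hyps in auto)
  qed
qed

section \<open>Picard series for the normalised first column of the Jost solution\<close>

locale dirac_potential =
  fixes q q' :: "real \<Rightarrow> complex" and \<alpha> \<beta> :: real
  assumes deriv_q: "\<And>t. (q has_vector_derivative q' t) (at t)"
    and cont_q': "continuous_on UNIV q'"
    and less: "\<alpha> < \<beta>"
begin

lemma cont_q: "continuous_on S q"
  using deriv_q by (meson continuous_at_imp_continuous_on has_vector_derivative_continuous)

text \<open>With \<open>(A, B)\<close> the coefficients of the first column of \<open>T\<^sub>-\<close> in the basis of free solutions,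
  \<open>C = exp (i k t) B\<close>. The system \<open>A' = cnj q C\<close>, \<open>C' = i k C + q A\<close> has no growing
  coefficients when \<open>Im k \<ge> 0\<close>. Its Picard series is used because every term is a polynomial in
  \<open>k\<close>, so that the sum is entire in \<open>k\<close>.\<close>

fun picard :: "nat \<Rightarrow> complex \<Rightarrow> real \<Rightarrow> complex \<times> complex" where
  "picard 0 k t = (1, 0)"
| "picard (Suc n) k t =
    (integral {\<alpha>..t} (\<lambda>s. cnj (q s) * snd (picard n k s)),
     integral {\<alpha>..t} (\<lambda>s. \<i> * k * snd (picard n k s) + q s * fst (picard n k s)))"

lemma parampoly_picard:
  "parampoly \<alpha> \<beta> (\<lambda>k t. fst (picard n k t)) \<and> parampoly \<alpha> \<beta> (\<lambda>k t. snd (picard n k t))"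
proof (induction n)
  case 0
  show ?case
    using parampoly.monomial[of \<alpha> \<beta> "\<lambda>_. 1" 0] parampoly.monomial[of \<alpha> \<beta> "\<lambda>_. 0" 0] by simp
next
  case (Suc n)
  have "parampoly \<alpha> \<beta> (\<lambda>k t. cnj (q t) * k ^ 0 * snd (picard n k t))"
    by (rule parampoly_mult) (use Suc in \<open>auto intro!: continuous_intros cont_q\<close>)
  moreover have "parampoly \<alpha> \<beta> (\<lambda>k t. \<i> * k ^ 1 * snd (picard n k t))"
    by (rule parampoly_mult) (use Suc in \<open>auto intro!: continuous_intros cont_q\<close>)
  moreover have "parampoly \<alpha> \<beta> (\<lambda>k t. q t * k ^ 0 * fst (picard n k t))"
    by (rule parampoly_mult) (use Suc in \<open>auto intro!: continuous_intros cont_q\<close>)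
  ultimately have "parampoly \<alpha> \<beta> (\<lambda>k t. cnj (q t) * snd (picard n k t))"
    "parampoly \<alpha> \<beta> (\<lambda>k t. \<i> * k * snd (picard n k t) + q t * fst (picard n k t))"
    by (simp_all add: parampoly.add)
  then show ?case
    using parampoly_integral by simp
qed

lemma picard_continuous [continuous_intros]:
  "t \<le> \<beta> \<Longrightarrow> continuous_on {\<alpha>..t} (\<lambda>t. fst (picard n k t))"
  "t \<le> \<beta> \<Longrightarrow> continuous_on {\<alpha>..t} (\<lambda>t. snd (picard n k t))"
  by (rule continuous_on_subset[OF parampoly_continuous_snd], use parampoly_picard in blast, simp)+

definition qmax :: real where "qmax = (SUP t\<in>{\<alpha>..\<beta>}. norm (q t))"

lemma norm_q_le: "t \<in> {\<alpha>..\<beta>} \<Longrightarrow> norm (q t) \<le> qmax"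
  unfolding qmax_def
  by (intro cSUP_upper bounded_imp_bdd_above compact_imp_bounded compact_continuous_image)
     (auto intro!: continuous_intros cont_q)

lemma qmax_nonneg: "0 \<le> qmax"
  using order_trans[OF norm_ge_zero norm_q_le[of \<alpha>]] less by simp

text \<open>In the sum norm the coefficient matrix of the system has norm at most
  \<open>qmax + R\<close>, so each integration contributes this factor and raises
  \<open>(t - \<alpha>)^n / n!\<close> by one degree.\<close>

lemma norm_picard_le:
  assumes "t \<in> {\<alpha>..\<beta>}" "norm k \<le> R"
  shows "norm (fst (picard n k t)) + norm (snd (picard n k t)) \<le> (qmax + R) ^ n * (t - \<alpha>) ^ n / fact n"
  using assms(1)
proof (induction n arbitrary: t)
  case 0
  then show ?case by simp
next
  case (Suc n)
  have R: "0 \<le> R" using assms(2) norm_ge_zero order_trans by blast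
  let ?g = "\<lambda>s. (qmax + R) ^ n * (s - \<alpha>) ^ n / fact n"
  have t: "t \<le> \<beta>" "\<alpha> \<le> t" using Suc.prems by auto
  have int: "((\<lambda>s. (qmax + R) * ?g s) has_integral (qmax + R) ^ Suc n * (t - \<alpha>) ^ Suc n / fact (Suc n)) {\<alpha>..t}"
  proof -
    have "((\<lambda>s. (qmax + R) * ?g s) has_integral
        (qmax + R) ^ Suc n * (t - \<alpha>) ^ Suc n / fact (Suc n) - (qmax + R) ^ Suc n * (\<alpha> - \<alpha>) ^ Suc n / fact (Suc n)) {\<alpha>..t}"
      using t(2)
    proof (rule fundamental_theorem_of_calculus)
      fix s
      have "((\<lambda>s. (qmax + R) ^ Suc n * (s - \<alpha>) ^ Suc n / fact (Suc n)) has_real_derivative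
          (qmax + R) ^ Suc n * (real (Suc n) * (s - \<alpha>) ^ n) / fact (Suc n)) (at s within {\<alpha>..t})"
        by (auto intro!: derivative_eq_intros simp del: power_Suc)
      also have "(qmax + R) ^ Suc n * (real (Suc n) * (s - \<alpha>) ^ n) / fact (Suc n) = (qmax + R) * ?g s"
        by (simp add: field_simps del: of_nat_Suc)
      finally show "((\<lambda>s. (qmax + R) ^ Suc n * (s - \<alpha>) ^ Suc n / fact (Suc n)) has_vector_derivative
          (qmax + R) * ?g s) (at s within {\<alpha>..t})"
        by (simp add: has_real_derivative_iff_has_vector_derivative)
    qed
    then show ?thesis by simp
  qed
  let ?u = "\<lambda>s. cnj (q s) * snd (picard n k s)"
  let ?v = "\<lambda>s. \<i> * k * snd (picard n k s) + q s * fst (picard n k s)"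
  have cont: "continuous_on {\<alpha>..t} ?u" "continuous_on {\<alpha>..t} ?v"
    using t by (auto intro!: continuous_intros cont_q)
  note int_uv = integrable_continuous_real[OF cont(1)] integrable_continuous_real[OF cont(2)]
    integrable_continuous_real[OF continuous_on_norm[OF cont(1)]]
    integrable_continuous_real[OF continuous_on_norm[OF cont(2)]]
  have "norm (integral {\<alpha>..t} ?u) + norm (integral {\<alpha>..t} ?v)
      \<le> integral {\<alpha>..t} (\<lambda>s. norm (?u s)) + integral {\<alpha>..t} (\<lambda>s. norm (?v s))"
    using int_uv by (intro add_mono integral_norm_bound_integral) auto
  also have "\<dots> = integral {\<alpha>..t} (\<lambda>s. norm (?u s) + norm (?v s))"
    using int_uv by (intro integral_add[symmetric])
  also have "\<dots> \<le> integral {\<alpha>..t} (\<lambda>s. (qmax + R) * ?g s)"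
  proof (rule integral_le)
    show "(\<lambda>s. norm (?u s) + norm (?v s)) integrable_on {\<alpha>..t}"
      using int_uv by (intro integrable_add)
    show "(\<lambda>s. (qmax + R) * ?g s) integrable_on {\<alpha>..t}"
      using int by blast
    fix s assume s: "s \<in> {\<alpha>..t}"
    then have s': "s \<in> {\<alpha>..\<beta>}" using t by auto
    have "norm (?u s) + norm (?v s) \<le> norm (q s) * norm (snd (picard n k s))
        + (norm k * norm (snd (picard n k s)) + norm (q s) * norm (fst (picard n k s)))"
      by (intro add_mono order_trans[OF norm_triangle_ineq]) (auto simp: norm_mult)
    \<comment> \<open>The coefficient of the \<open>fst\<close> term is enlarged from
      \<open>qmax\<close> to \<open>qmax + R\<close> so that the sum of the two norms factors
      out.\<close>
    also have "\<dots> \<le> qmax * norm (snd (picard n k s))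
        + (R * norm (snd (picard n k s)) + (qmax + R) * norm (fst (picard n k s)))"
      using norm_q_le[OF s'] assms(2) R by (intro add_mono mult_right_mono) auto
    also have "\<dots> = (qmax + R) * (norm (fst (picard n k s)) + norm (snd (picard n k s)))"
      by (simp add: algebra_simps)
    also have "\<dots> \<le> (qmax + R) * ?g s"
      using Suc.IH[OF s'] R qmax_nonneg by (intro mult_left_mono) auto
    finally show "norm (?u s) + norm (?v s) \<le> (qmax + R) * ?g s" .
  qed
  finally show ?case using integral_unique[OF int] by simp
qed

definition A :: "complex \<Rightarrow> real \<Rightarrow> complex" where "A k t = (\<Sum>n. fst (picard n k t))"
definition C :: "complex \<Rightarrow> real \<Rightarrow> complex" where "C k t = (\<Sum>n. snd (picard n k t))"

lemma uniform_limit_picard: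
  "uniform_limit (cball 0 R \<times> {\<alpha>..\<beta>}) (\<lambda>n (k, t). \<Sum>i<n. fst (picard i k t)) (\<lambda>(k, t). A k t) sequentially"
  "uniform_limit (cball 0 R \<times> {\<alpha>..\<beta>}) (\<lambda>n (k, t). \<Sum>i<n. snd (picard i k t)) (\<lambda>(k, t). C k t) sequentially"
proof -
  define b where "b = (\<lambda>n. ((qmax + R) * (\<beta> - \<alpha>)) ^ n / fact n)"
  have "summable b"
    using summable_exp[of "(qmax + R) * (\<beta> - \<alpha>)"] by (simp add: b_def divide_inverse mult.commute)
  have bound: "norm (fst (picard n k t)) \<le> b n" "norm (snd (picard n k t)) \<le> b n"
    if "(k, t) \<in> cball 0 R \<times> {\<alpha>..\<beta>}" for n k t
  proof -
    have k: "norm k \<le> R" "t \<in> {\<alpha>..\<beta>}" using that by auto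
    then have R: "0 \<le> R" using norm_ge_zero order_trans by blast
    have "(qmax + R) ^ n * (t - \<alpha>) ^ n / fact n \<le> (qmax + R) ^ n * (\<beta> - \<alpha>) ^ n / fact n"
      using k R qmax_nonneg by (intro divide_right_mono mult_left_mono power_mono) auto
    also have "\<dots> = b n" by (simp add: b_def power_mult_distrib)
    finally show "norm (fst (picard n k t)) \<le> b n" "norm (snd (picard n k t)) \<le> b n"
      using norm_picard_le[OF k(2,1), of n] norm_ge_zero[of "fst (picard n k t)"]
        norm_ge_zero[of "snd (picard n k t)"] by linarith+
  qed
  show "uniform_limit (cball 0 R \<times> {\<alpha>..\<beta>}) (\<lambda>n (k, t). \<Sum>i<n. fst (picard i k t)) (\<lambda>(k, t). A k t) sequentially"
    unfolding A_def split_beta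
    by (rule Weierstrass_m_test[OF _ \<open>summable b\<close>]) (metis bound prod.collapse)
  show "uniform_limit (cball 0 R \<times> {\<alpha>..\<beta>}) (\<lambda>n (k, t). \<Sum>i<n. snd (picard i k t)) (\<lambda>(k, t). C k t) sequentially"
    unfolding C_def split_beta
    by (rule Weierstrass_m_test[OF _ \<open>summable b\<close>]) (metis bound prod.collapse)
qed

lemma continuous_AC:
  "continuous_on (UNIV \<times> {\<alpha>..\<beta>}) (\<lambda>(k, t). A k t)"
  "continuous_on (UNIV \<times> {\<alpha>..\<beta>}) (\<lambda>(k, t). C k t)"
proof -
  have "parampoly \<alpha> \<beta> (\<lambda>k t. \<Sum>i<n. fst (picard i k t))" "parampoly \<alpha> \<beta> (\<lambda>k t. \<Sum>i<n. snd (picard i k t))" for n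
    using parampoly_picard parampoly.monomial[of \<alpha> \<beta> "\<lambda>_. 0" 0]
    by (induction n) (simp_all add: parampoly.add)
  from this[THEN parampoly_continuous]
  have c: "continuous_on (cball 0 R \<times> {\<alpha>..\<beta>}) (\<lambda>(k, t). \<Sum>i<n. fst (picard i k t))"
    "continuous_on (cball 0 R \<times> {\<alpha>..\<beta>}) (\<lambda>(k, t). \<Sum>i<n. snd (picard i k t))" for R n
    by (blast intro: continuous_on_subset)+
  show "continuous_on (UNIV \<times> {\<alpha>..\<beta>}) (\<lambda>(k, t). A k t)"
    "continuous_on (UNIV \<times> {\<alpha>..\<beta>}) (\<lambda>(k, t). C k t)"
    by (rule continuous_on_of_cballs, rule uniform_limit_theorem[OF always_eventually uniform_limit_picard(1)],
          use c in auto)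
       (rule continuous_on_of_cballs, rule uniform_limit_theorem[OF always_eventually uniform_limit_picard(2)],
          use c in auto)
qed

lemma continuous_AC_snd [continuous_intros]:
  "t \<le> \<beta> \<Longrightarrow> continuous_on {\<alpha>..t} (A k)" "t \<le> \<beta> \<Longrightarrow> continuous_on {\<alpha>..t} (C k)"
proof -
  assume "t \<le> \<beta>"
  then have sub: "(\<lambda>t. (k, t)) ` {\<alpha>..t} \<subseteq> UNIV \<times> {\<alpha>..\<beta>}"
    by auto
  have pair: "continuous_on {\<alpha>..t} (\<lambda>t. (k, t))"
    by (intro continuous_intros)
  show "continuous_on {\<alpha>..t} (A k)" "continuous_on {\<alpha>..t} (C k)"
    using continuous_on_compose2[OF continuous_AC(1) pair sub] continuous_on_compose2[OF continuous_AC(2) pair sub]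
    by simp_all
qed

lemma holomorphic_A:
  assumes "t \<in> {\<alpha>..\<beta>}"
  shows "(\<lambda>k. A k t) holomorphic_on UNIV"
proof (rule holomorphic_uniform_sequence)
  show "(\<lambda>k. \<Sum>i<n. fst (picard i k t)) holomorphic_on UNIV" for n
    using parampoly_picard assms by (intro holomorphic_on_sum parampoly_holomorphic) auto
  fix k :: complex
  have "uniform_limit (cball k 1) (\<lambda>n k. \<Sum>i<n. fst (picard i k t)) (\<lambda>k. A k t) sequentially"
    unfolding uniform_limit_iff
  proof safe
    fix e :: real assume "e > 0"
    from uniform_limitD[OF uniform_limit_picard(1)[of "norm k + 1"] this]
    show "\<forall>\<^sub>F n in sequentially. \<forall>x\<in>cball k 1. dist (\<Sum>i<n. fst (picard i x t)) (A x t) < e"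
    proof eventually_elim
      case (elim n)
      show ?case
      proof
        fix x assume "x \<in> cball k 1"
        then have "norm x \<le> norm k + 1"
          by (simp add: dist_norm) (metis norm_minus_commute norm_triangle_sub add.commute add_left_mono order_trans)
        then show "dist (\<Sum>i<n. fst (picard i x t)) (A x t) < e"
          using elim assms by auto
      qed
    qed
  qed
  then show "\<exists>d>0. cball k d \<subseteq> UNIV \<and>
      uniform_limit (cball k d) (\<lambda>n k. \<Sum>i<n. fst (picard i k t)) (\<lambda>k. A k t) sequentially"
    by (intro exI[of _ 1]) auto
qed auto

lemma sums_AC:
  assumes "t \<in> {\<alpha>..\<beta>}"
  shows "(\<lambda>n. fst (picard n k t)) sums A k t" "(\<lambda>n. snd (picard n k t)) sums C k t"
  using tendsto_uniform_limitI[OF uniform_limit_picard(1), of "(k, t)" "norm k"]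
    tendsto_uniform_limitI[OF uniform_limit_picard(2), of "(k, t)" "norm k"] assms
  by (auto simp: sums_def)

lemma AC_integral_eq:
  assumes t: "t \<in> {\<alpha>..\<beta>}"
  shows "A k t = 1 + integral {\<alpha>..t} (\<lambda>s. cnj (q s) * C k s)"
    "C k t = integral {\<alpha>..t} (\<lambda>s. \<i> * k * C k s + q s * A k s)"
proof -
  let ?U = "\<lambda>n s. cnj (q s) * (\<Sum>i<n. snd (picard i k s))"
  let ?V = "\<lambda>n s. \<i> * k * (\<Sum>i<n. snd (picard i k s)) + q s * (\<Sum>i<n. fst (picard i k s))"
  have bq: "bounded (q ` {\<alpha>..t})" "bounded ((\<lambda>s. cnj (q s)) ` {\<alpha>..t})"
    by (auto intro!: compact_imp_bounded compact_continuous_image continuous_intros cont_q)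
  have b: "bounded (A k ` {\<alpha>..t})" "bounded (C k ` {\<alpha>..t})"
    using t by (auto intro!: compact_imp_bounded compact_continuous_image continuous_intros)
  have u: "uniform_limit {\<alpha>..t} (\<lambda>n s. \<Sum>i<n. fst (picard i k s)) (A k) sequentially"
    "uniform_limit {\<alpha>..t} (\<lambda>n s. \<Sum>i<n. snd (picard i k s)) (C k) sequentially"
    using uniform_limit_compose'[OF uniform_limit_picard(1)[of "norm k"], of "\<lambda>s. (k, s)" "{\<alpha>..t}"]
      uniform_limit_compose'[OF uniform_limit_picard(2)[of "norm k"], of "\<lambda>s. (k, s)" "{\<alpha>..t}"] t
    by (auto simp: o_def)
  have "uniform_limit {\<alpha>..t} ?U (\<lambda>s. cnj (q s) * C k s) sequentially"
    by (rule uniform_lim_mult[OF uniform_limit_const u(2) bq(2) b(2)])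
  moreover have "continuous_on {\<alpha>..t} (?U n)" for n
    using t by (auto intro!: continuous_intros cont_q)
  ultimately obtain I J where
    IJ: "\<And>n. (?U n has_integral I n) {\<alpha>..t}" "((\<lambda>s. cnj (q s) * C k s) has_integral J) {\<alpha>..t}" "I \<longlonglongrightarrow> J"
    by (rule uniform_limit_integral) auto
  \<comment> \<open>Index shift: term 0 is the constant 1, and every later term is the integral
    built from its predecessor.\<close>
  have "(\<Sum>i<Suc n. fst (picard i k t)) = 1 + I n" for n
  proof -
    have "I n = integral {\<alpha>..t} (\<lambda>s. \<Sum>i<n. cnj (q s) * snd (picard i k s))"
      using integral_unique[OF IJ(1)[of n]] by (simp add: sum_distrib_left)
    also have "\<dots> = (\<Sum>i<n. integral {\<alpha>..t} (\<lambda>s. cnj (q s) * snd (picard i k s)))"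
      using t by (intro integral_sum integrable_continuous_real continuous_intros cont_q) auto
    finally show ?thesis by (simp add: sum.lessThan_Suc_shift del: sum.lessThan_Suc)
  qed
  moreover have "(\<lambda>n. \<Sum>i<Suc n. fst (picard i k t)) \<longlonglongrightarrow> A k t"
    using sums_AC(1)[OF t, of k] unfolding sums_def by (rule LIMSEQ_Suc)
  ultimately have "A k t = 1 + J"
    using tendsto_add[OF tendsto_const IJ(3), of 1] LIMSEQ_unique by auto
  then show "A k t = 1 + integral {\<alpha>..t} (\<lambda>s. cnj (q s) * C k s)"
    using IJ(2) by (simp add: integral_unique)
  have "uniform_limit {\<alpha>..t} ?V (\<lambda>s. \<i> * k * C k s + q s * A k s) sequentially"
    by (intro uniform_limit_add uniform_lim_mult[OF uniform_limit_const] u bq b) (auto simp: image_constant_conv)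
  moreover have "continuous_on {\<alpha>..t} (?V n)" for n
    using t by (auto intro!: continuous_intros cont_q)
  ultimately obtain I J where
    IJ: "\<And>n. (?V n has_integral I n) {\<alpha>..t}" "((\<lambda>s. \<i> * k * C k s + q s * A k s) has_integral J) {\<alpha>..t}" "I \<longlonglongrightarrow> J"
    by (rule uniform_limit_integral) auto
  have "(\<Sum>i<Suc n. snd (picard i k t)) = I n" for n
  proof -
    have "I n = integral {\<alpha>..t} (\<lambda>s. \<Sum>i<n. \<i> * k * snd (picard i k s) + q s * fst (picard i k s))"
      using integral_unique[OF IJ(1)[of n]] by (simp add: sum_distrib_left sum.distrib)
    also have "\<dots> = (\<Sum>i<n. integral {\<alpha>..t} (\<lambda>s. \<i> * k * snd (picard i k s) + q s * fst (picard i k s)))"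
      using t by (intro integral_sum integrable_continuous_real continuous_intros cont_q) auto
    finally show ?thesis by (simp add: sum.lessThan_Suc_shift del: sum.lessThan_Suc)
  qed
  moreover have "(\<lambda>n. \<Sum>i<Suc n. snd (picard i k t)) \<longlonglongrightarrow> C k t"
    using sums_AC(2)[OF t, of k] unfolding sums_def by (rule LIMSEQ_Suc)
  ultimately have "C k t = J"
    using IJ(3) LIMSEQ_unique by auto
  then show "C k t = integral {\<alpha>..t} (\<lambda>s. \<i> * k * C k s + q s * A k s)"
    using IJ(2) by (simp add: integral_unique)
qed

lemma AC_start: "A k \<alpha> = 1" "C k \<alpha> = 0"
  using AC_integral_eq[of \<alpha> k] less by auto

lemma deriv_AC [derivative_intros]:
  assumes t: "t \<in> {\<alpha>..\<beta>}"
  shows "(A k has_vector_derivative cnj (q t) * C k t) (at t within {\<alpha>..\<beta>})"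
    "(C k has_vector_derivative \<i> * k * C k t + q t * A k t) (at t within {\<alpha>..\<beta>})"
proof -
  have "((\<lambda>t. 1 + integral {\<alpha>..t} (\<lambda>s. cnj (q s) * C k s)) has_vector_derivative 0 + cnj (q t) * C k t) (at t within {\<alpha>..\<beta>})"
    by (intro has_vector_derivative_add has_vector_derivative_const integral_has_vector_derivative t
        continuous_intros cont_q) auto
  then show "(A k has_vector_derivative cnj (q t) * C k t) (at t within {\<alpha>..\<beta>})"
    by (intro has_vector_derivative_transform[OF t AC_integral_eq(1)]) auto
  have "((\<lambda>t. integral {\<alpha>..t} (\<lambda>s. \<i> * k * C k s + q s * A k s)) has_vector_derivative
      \<i> * k * C k t + q t * A k t) (at t within {\<alpha>..\<beta>})"
    by (intro integral_has_vector_derivative t continuous_intros cont_q) auto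
  then show "(C k has_vector_derivative \<i> * k * C k t + q t * A k t) (at t within {\<alpha>..\<beta>})"
    by (intro has_vector_derivative_transform[OF t AC_integral_eq(2)]) auto
qed

lemma deriv_AC_within:
  assumes "s \<in> {\<alpha>..t}" "t \<le> \<beta>"
  shows "(A k has_vector_derivative cnj (q s) * C k s) (at s within {\<alpha>..t})"
    "(C k has_vector_derivative \<i> * k * C k s + q s * A k s) (at s within {\<alpha>..t})"
  using assms by (auto intro!: has_vector_derivative_within_subset[OF deriv_AC(1)]
      has_vector_derivative_within_subset[OF deriv_AC(2)])

text \<open>The contributions of \<open>q\<close> to |A|^2 and |C|^2 are equal and cancel; only the
  diagonal term \<open>\<i> * k * C\<close> survives. For real \<open>k\<close> this is the
  conservation law |a|^2 - |b|^2 = 1, and for Im k >= 0 the difference can only grow, which keeps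
  \<open>A\<close> away from zero.\<close>

lemma deriv_energy:
  assumes "s \<in> {\<alpha>..t}" "t \<le> \<beta>"
  shows "((\<lambda>s. (norm (A k s))\<^sup>2 - (norm (C k s))\<^sup>2) has_vector_derivative 2 * Im k * (norm (C k s))\<^sup>2)
    (at s within {\<alpha>..t})"
proof -
  note d = deriv_AC_within[OF assms, of k]
  have "((\<lambda>s. A k s * cnj (A k s) - C k s * cnj (C k s)) has_vector_derivative
      (A k s * cnj (cnj (q s) * C k s) + cnj (q s) * C k s * cnj (A k s)) -
      (C k s * cnj (\<i> * k * C k s + q s * A k s) + (\<i> * k * C k s + q s * A k s) * cnj (C k s)))
      (at s within {\<alpha>..t})"
    by (intro has_vector_derivative_diff has_vector_derivative_mult has_vector_derivative_cnj d)
  from has_vector_derivative_Re[OF this]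
  have "((\<lambda>s. (norm (A k s))\<^sup>2 - (norm (C k s))\<^sup>2) has_vector_derivative
     Re ((A k s * cnj (cnj (q s) * C k s) + cnj (q s) * C k s * cnj (A k s)) -
      (C k s * cnj (\<i> * k * C k s + q s * A k s) + (\<i> * k * C k s + q s * A k s) * cnj (C k s))))
      (at s within {\<alpha>..t})"
    by (simp only: complex_norm_square[symmetric] minus_complex.simps Re_complex_of_real)
  also have "Re ((A k s * cnj (cnj (q s) * C k s) + cnj (q s) * C k s * cnj (A k s)) -
      (C k s * cnj (\<i> * k * C k s + q s * A k s) + (\<i> * k * C k s + q s * A k s) * cnj (C k s)))
    = 2 * Im k * (norm (C k s))\<^sup>2"
    unfolding cmod_power2 by (simp add: power2_eq_square algebra_simps)
  finally show ?thesis .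
qed

lemma energy_ge:
  assumes "t \<in> {\<alpha>..\<beta>}" "Im k \<ge> 0"
  shows "1 + (norm (C k t))\<^sup>2 \<le> (norm (A k t))\<^sup>2"
proof -
  have "(norm (A k \<alpha>))\<^sup>2 - (norm (C k \<alpha>))\<^sup>2 \<le> (norm (A k t))\<^sup>2 - (norm (C k t))\<^sup>2"
    by (rule has_vector_derivative_nonneg_le[OF _ deriv_energy]) (use assms in auto)
  then show ?thesis by (simp add: AC_start)
qed

lemma energy_eq:
  assumes "t \<in> {\<alpha>..\<beta>}" "Im k = 0"
  shows "(norm (A k t))\<^sup>2 = 1 + (norm (C k t))\<^sup>2"
proof -
  have "norm (((norm (A k t))\<^sup>2 - (norm (C k t))\<^sup>2) - ((norm (A k \<alpha>))\<^sup>2 - (norm (C k \<alpha>))\<^sup>2)) \<le> 0 * (t - \<alpha>)"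
    by (rule has_vector_derivative_norm_bound[OF _ deriv_energy]) (use assms in auto)
  then show ?thesis by (simp add: AC_start)
qed

lemma A_nonzero:
  assumes "t \<in> {\<alpha>..\<beta>}" "Im k \<ge> 0"
  shows "A k t \<noteq> 0"
proof
  assume "A k t = 0"
  then have "1 + (norm (C k t))\<^sup>2 \<le> 0" using energy_ge[OF assms] by simp
  then show False using zero_le_power2[of "norm (C k t)"] by linarith
qed

section \<open>Reflection coefficient and the logarithm of \<open>A\<close>\<close>

definition \<rho> :: "complex \<Rightarrow> real \<Rightarrow> complex" where "\<rho> k t = C k t / A k t"

lemma norm_rho_le:
  assumes "t \<in> {\<alpha>..\<beta>}" "Im k \<ge> 0"
  shows "norm (\<rho> k t) \<le> 1"
proof -
  have "(norm (C k t))\<^sup>2 \<le> (norm (A k t))\<^sup>2" using energy_ge[OF assms] by linarith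
  then have "norm (C k t) \<le> norm (A k t)" by (rule power2_le_imp_le) simp
  then show ?thesis using A_nonzero[OF assms] by (simp add: \<rho>_def norm_divide)
qed

lemma deriv_rho:
  assumes t: "t \<in> {\<alpha>..\<beta>}" and k: "Im k \<ge> 0"
  shows "(\<rho> k has_vector_derivative \<i> * k * \<rho> k t + q t - cnj (q t) * (\<rho> k t)\<^sup>2) (at t within {\<alpha>..\<beta>})"
proof -
  have "((\<lambda>t. C k t / A k t) has_vector_derivative
     ((\<i> * k * C k t + q t * A k t) * A k t - C k t * (cnj (q t) * C k t)) / (A k t * A k t)) (at t within {\<alpha>..\<beta>})"
    by (intro has_vector_derivative_quotient A_nonzero deriv_AC t k)
  also have "((\<i> * k * C k t + q t * A k t) * A k t - C k t * (cnj (q t) * C k t)) / (A k t * A k t)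
      = \<i> * k * \<rho> k t + q t - cnj (q t) * (\<rho> k t)\<^sup>2"
    using A_nonzero[OF assms] by (simp add: \<rho>_def field_simps power2_eq_square)
  finally show ?thesis by (simp add: \<rho>_def [abs_def])
qed

lemma continuous_rho:
  "continuous_on ({k. Im k \<ge> 0} \<times> {\<alpha>..\<beta>}) (\<lambda>(k, t). \<rho> k t)"
proof -
  have "continuous_on ({k. Im k \<ge> 0} \<times> {\<alpha>..\<beta>}) (\<lambda>z. (\<lambda>(k, t). C k t) z / (\<lambda>(k, t). A k t) z)"
    by (intro continuous_on_divide continuous_on_subset[OF continuous_AC(1)]
        continuous_on_subset[OF continuous_AC(2)]) (auto simp: A_nonzero)
  then show ?thesis by (simp add: \<rho>_def split_beta)
qed

lemma continuous_rho_snd: "Im k \<ge> 0 \<Longrightarrow> continuous_on {\<alpha>..\<beta>} (\<rho> k)"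
  by (rule continuous_on_vector_derivative[OF deriv_rho])

text \<open>Since A'/A = cnj q * \<rho>, this is the logarithm of \<open>A\<close> followed
  continuously in \<open>t\<close> from the value 0 at \<open>\<alpha>\<close>. No branch cut has to
  be avoided, however often \<open>A\<close> turns around the origin.\<close>

definition F :: "complex \<Rightarrow> real \<Rightarrow> complex" where
  "F k t = integral {\<alpha>..t} (\<lambda>s. cnj (q s) * \<rho> k s)"

lemma deriv_F:
  assumes t: "t \<in> {\<alpha>..\<beta>}" and k: "Im k \<ge> 0"
  shows "(F k has_vector_derivative cnj (q t) * \<rho> k t) (at t within {\<alpha>..\<beta>})"
proof -
  have "continuous_on {\<alpha>..\<beta>} (\<lambda>s. cnj (q s) * \<rho> k s)"
    by (intro continuous_on_mult continuous_on_cnj cont_q continuous_rho_snd k)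
  from integral_has_vector_derivative[OF this t] show ?thesis
    unfolding F_def[abs_def] .
qed

lemma exp_F:
  assumes t: "t \<in> {\<alpha>..\<beta>}" and k: "Im k \<ge> 0"
  shows "exp (F k t) = A k t"
proof -
  have "((\<lambda>t. A k t * exp (- F k t)) has_vector_derivative 0) (at t within {\<alpha>..\<beta>})" if t: "t \<in> {\<alpha>..\<beta>}" for t
  proof -
    have "((\<lambda>t. A k t * exp (- F k t)) has_vector_derivative
        A k t * (- (cnj (q t) * \<rho> k t) * exp (- F k t)) + cnj (q t) * C k t * exp (- F k t)) (at t within {\<alpha>..\<beta>})"
      by (intro has_vector_derivative_mult has_vector_derivative_exp has_vector_derivative_minus
          deriv_F deriv_AC t k)
    then show ?thesis using A_nonzero[OF t k] by (simp add: \<rho>_def)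
  qed
  then obtain c where c: "\<And>t. t \<in> {\<alpha>..\<beta>} \<Longrightarrow> A k t * exp (- F k t) = c"
    using has_vector_derivative_zero_constant[of "{\<alpha>..\<beta>}" "\<lambda>t. A k t * exp (- F k t)"] by blast
  have "A k t * exp (- F k t) = 1"
    using c[of \<alpha>] less unfolding c[OF t] by (simp add: AC_start F_def)
  then have "A k t * exp (- F k t) * exp (F k t) = exp (F k t)" by simp
  then show ?thesis by (simp add: mult.assoc flip: exp_add)
qed

lemma continuous_F: "continuous_on {k. Im k \<ge> 0} (\<lambda>k. F k \<beta>)"
proof -
  have "continuous_on ({k. Im k \<ge> 0} \<times> cbox \<alpha> \<beta>) (\<lambda>(k, s). cnj (q s) * \<rho> k s)"
    using continuous_rho unfolding split_beta
    by (auto intro!: continuous_intros continuous_on_compose2[OF cont_q[of UNIV]])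
  from integral_continuous_on_param[OF this] show ?thesis by (simp add: F_def)
qed

lemma holomorphic_F: "(\<lambda>k. F k \<beta>) holomorphic_on {k. Im k > 0}"
proof (rule holomorphic_on_continuous_log)
  show "continuous_on {k. Im k > 0} (\<lambda>k. F k \<beta>)"
    by (rule continuous_on_subset[OF continuous_F]) auto
  have "(\<lambda>k. exp (F k \<beta>)) holomorphic_on {k. Im k > 0} \<longleftrightarrow> (\<lambda>k. A k \<beta>) holomorphic_on {k. Im k > 0}"
    using less by (intro holomorphic_cong) (auto simp: exp_F)
  then show "(\<lambda>k. exp (F k \<beta>)) holomorphic_on {k. Im k > 0}"
    using holomorphic_on_subset[OF holomorphic_A] less by auto
qed (rule open_halfspace_Im_gt)

section \<open>Decay for large spectral parameter\<close>

lemma q'_bounded: obtains Q where "\<And>t. t \<in> {\<alpha>..\<beta>} \<Longrightarrow> norm (q' t) \<le> Q" "Q \<ge> 0"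
proof -
  have "bounded (q' ` {\<alpha>..\<beta>})"
    by (intro compact_imp_bounded compact_continuous_image continuous_on_subset[OF cont_q']) auto
  then obtain Q where "Q > 0" "\<forall>x\<in>q' ` {\<alpha>..\<beta>}. norm x \<le> Q" unfolding bounded_pos by blast
  then show ?thesis using that[of Q] by auto
qed

text \<open>Integration by parts: in the derivative of \<open>\<i> * k * F - cnj q * \<rho>\<close>
  the Riccati equation cancels the terms with a factor \<open>k\<close>, leaving
  \<open>|q|^2\<close>, \<open>cnj q^2 \<rho>^2\<close> and \<open>cnj q' \<rho>\<close>. At
  \<open>\<alpha>\<close> the combination vanishes, and the boundary term at \<open>\<beta>\<close>
  costs \<open>qmax\<close>. All bounds use |\<rho>| <= 1 and so are uniform in
  \<open>k\<close>.\<close>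

lemma F_decay: obtains K where "\<And>k. Im k \<ge> 0 \<Longrightarrow> norm k * norm (F k \<beta>) \<le> K" "K \<ge> 0"
proof -
  obtain Q where Q: "\<And>t. t \<in> {\<alpha>..\<beta>} \<Longrightarrow> norm (q' t) \<le> Q" "Q \<ge> 0" using q'_bounded by metis
  let ?K = "qmax + (Q + 2 * qmax\<^sup>2) * (\<beta> - \<alpha>)"
  show ?thesis
  proof
    fix k :: complex assume k: "Im k \<ge> 0"
    have "norm ((\<i> * k * F k \<beta> - cnj (q \<beta>) * \<rho> k \<beta>) - (\<i> * k * F k \<alpha> - cnj (q \<alpha>) * \<rho> k \<alpha>)) \<le>
        (Q + 2 * qmax\<^sup>2) * (\<beta> - \<alpha>)"
    proof (rule has_vector_derivative_norm_bound)
      fix t assume t: "t \<in> {\<alpha>..\<beta>}"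
      have "((\<lambda>t. \<i> * k * F k t - cnj (q t) * \<rho> k t) has_vector_derivative
         \<i> * k * (cnj (q t) * \<rho> k t) - (cnj (q t) * (\<i> * k * \<rho> k t + q t - cnj (q t) * (\<rho> k t)\<^sup>2)
           + cnj (q' t) * \<rho> k t)) (at t within {\<alpha>..\<beta>})"
        using t k by (intro has_vector_derivative_diff has_vector_derivative_mult_right deriv_F
            has_vector_derivative_mult deriv_rho has_vector_derivative_cnj has_vector_derivative_at_within[OF deriv_q])
      also have "\<i> * k * (cnj (q t) * \<rho> k t) - (cnj (q t) * (\<i> * k * \<rho> k t + q t - cnj (q t) * (\<rho> k t)\<^sup>2)
           + cnj (q' t) * \<rho> k t) = cnj (q t) * cnj (q t) * (\<rho> k t)\<^sup>2 - (cnj (q t) * q t + cnj (q' t) * \<rho> k t)"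
        by (simp add: algebra_simps)
      finally show "((\<lambda>t. \<i> * k * F k t - cnj (q t) * \<rho> k t) has_vector_derivative
         cnj (q t) * cnj (q t) * (\<rho> k t)\<^sup>2 - (cnj (q t) * q t + cnj (q' t) * \<rho> k t)) (at t within {\<alpha>..\<beta>})" .
      have "norm (cnj (q t) * cnj (q t) * (\<rho> k t)\<^sup>2 - (cnj (q t) * q t + cnj (q' t) * \<rho> k t))
         \<le> norm (q t) * norm (q t) * (norm (\<rho> k t))\<^sup>2 + (norm (q t) * norm (q t) + norm (q' t) * norm (\<rho> k t))"
        by (intro order_trans[OF norm_triangle_ineq4] add_mono order_trans[OF norm_triangle_ineq])
           (auto simp: norm_mult norm_power)
      also have "\<dots> \<le> qmax * qmax * 1\<^sup>2 + (qmax * qmax + Q * 1)"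
        using norm_q_le[OF t] norm_rho_le[OF t k] Q(1)[OF t] Q(2) qmax_nonneg
        by (intro add_mono mult_mono power_mono) auto
      finally show "norm (cnj (q t) * cnj (q t) * (\<rho> k t)\<^sup>2 - (cnj (q t) * q t + cnj (q' t) * \<rho> k t)) \<le> Q + 2 * qmax\<^sup>2"
        by (simp add: power2_eq_square)
    qed (use less in auto)
    then have 1: "norm (\<i> * k * F k \<beta> - cnj (q \<beta>) * \<rho> k \<beta>) \<le> (Q + 2 * qmax\<^sup>2) * (\<beta> - \<alpha>)"
      by (simp add: F_def \<rho>_def AC_start)
    have b: "\<beta> \<in> {\<alpha>..\<beta>}" using less by auto
    have "norm (cnj (q \<beta>) * \<rho> k \<beta>) \<le> qmax * 1"
      unfolding norm_mult using norm_q_le[OF b] norm_rho_le[OF b k] qmax_nonneg by (intro mult_mono) auto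
    then have "norm (\<i> * k * F k \<beta>) \<le> ?K"
      using 1 norm_triangle_sub[of "\<i> * k * F k \<beta>" "cnj (q \<beta>) * \<rho> k \<beta>"] by linarith
    then show "norm k * norm (F k \<beta>) \<le> ?K" by (simp add: norm_mult)
  next
    show "?K \<ge> 0" using qmax_nonneg Q less by auto
  qed
qed

text \<open>Uniform in \<open>k\<close> thanks to |\<rho>| <= 1, unlike the Picard majorants, which
  grow with |k|.\<close>

lemma norm_F_le:
  assumes t: "t \<in> {\<alpha>..\<beta>}" and k: "Im k \<ge> 0"
  shows "norm (F k t) \<le> qmax * (\<beta> - \<alpha>)"
proof -
  have "norm (F k t - F k \<alpha>) \<le> qmax * (t - \<alpha>)"
  proof (rule has_vector_derivative_norm_bound)
    fix s assume s: "s \<in> {\<alpha>..t}"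
    then have s': "s \<in> {\<alpha>..\<beta>}" using t by auto
    show "(F k has_vector_derivative cnj (q s) * \<rho> k s) (at s within {\<alpha>..t})"
      by (rule has_vector_derivative_within_subset[OF deriv_F[OF s' k]]) (use t in auto)
    show "norm (cnj (q s) * \<rho> k s) \<le> qmax"
      using mult_mono[OF norm_q_le[OF s'] norm_rho_le[OF s' k]] qmax_nonneg by (simp add: norm_mult)
  qed (use t in auto)
  also have "\<dots> \<le> qmax * (\<beta> - \<alpha>)" using t qmax_nonneg by (intro mult_left_mono) auto
  finally show ?thesis by (simp add: F_def)
qed

text \<open>The O(1/|k|) bound on \<open>F\<close> does not make ln |a| integrable. By |A|^2 = 1 +
  |C|^2, ln |a| is at most |C|^2 / 2, so the same rate for \<open>C\<close> gives O(1/k^2). With the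
  free rotation removed by \<open>e = exp (- i k t)\<close>, one has (C e)' = q A e, and adding
  \<open>q A e\<close> to \<open>i k C e\<close> cancels the factor \<open>k\<close> in the
  derivative.\<close>

lemma C_decay: obtains K where "\<And>k. Im k = 0 \<Longrightarrow> norm k * norm (C k \<beta>) \<le> K" "K \<ge> 0"
proof -
  obtain Q where Q: "\<And>t. t \<in> {\<alpha>..\<beta>} \<Longrightarrow> norm (q' t) \<le> Q" "Q \<ge> 0" using q'_bounded by metis
  \<comment> \<open>A bound for |A| = exp (Re F) independent of \<open>k\<close>; by energy
    conservation it also bounds |C|.\<close>
  define M where "M = exp (qmax * (\<beta> - \<alpha>))"
  have A_le: "norm (A k t) \<le> M" if "t \<in> {\<alpha>..\<beta>}" "Im k = 0" for k t
  proof -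
    have "norm (A k t) = exp (Re (F k t))" using exp_F[of t k] that by (metis norm_exp_eq_Re order_refl)
    also have "\<dots> \<le> M" unfolding M_def
      using norm_F_le[of t k] that complex_Re_le_cmod[of "F k t"] by auto
    finally show ?thesis .
  qed
  have C_le: "norm (C k t) \<le> M" if "t \<in> {\<alpha>..\<beta>}" "Im k = 0" for k t
  proof -
    have "norm (C k t) \<le> norm (A k t)"
      by (rule power2_le_imp_le, use energy_eq[OF that] in linarith, simp)
    then show ?thesis using A_le[OF that] by linarith
  qed
  let ?K = "qmax * M + qmax + (Q * M + qmax * qmax * M) * (\<beta> - \<alpha>)"
  have M0: "M \<ge> 0" by (simp add: M_def)
  show ?thesis
  proof
    fix k :: complex assume k: "Im k = 0"
    define e where "e = (\<lambda>t. exp (- \<i> * k * of_real t))"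
    have ne: "norm (e t) = 1" for t using k by (simp add: e_def)
    have de: "(e has_vector_derivative - \<i> * k * e t) (at t within S)" for t S
      unfolding e_def by (rule has_vector_derivative_exp_linear)
    have "norm ((\<i> * k * (C k \<beta> * e \<beta>) + q \<beta> * (A k \<beta> * e \<beta>)) - (\<i> * k * (C k \<alpha> * e \<alpha>) + q \<alpha> * (A k \<alpha> * e \<alpha>)))
       \<le> (Q * M + qmax * qmax * M) * (\<beta> - \<alpha>)"
    proof (rule has_vector_derivative_norm_bound)
      fix t assume t: "t \<in> {\<alpha>..\<beta>}"
      have "((\<lambda>t. \<i> * k * (C k t * e t) + q t * (A k t * e t)) has_vector_derivative
         \<i> * k * (C k t * (- \<i> * k * e t) + (\<i> * k * C k t + q t * A k t) * e t) +
         (q t * (A k t * (- \<i> * k * e t) + cnj (q t) * C k t * e t) + q' t * (A k t * e t))) (at t within {\<alpha>..\<beta>})"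
        using t by (intro has_vector_derivative_add has_vector_derivative_mult_right
            has_vector_derivative_mult deriv_AC de has_vector_derivative_at_within[OF deriv_q])
      also have "\<i> * k * (C k t * (- \<i> * k * e t) + (\<i> * k * C k t + q t * A k t) * e t) +
         (q t * (A k t * (- \<i> * k * e t) + cnj (q t) * C k t * e t) + q' t * (A k t * e t))
         = q' t * A k t * e t + q t * cnj (q t) * C k t * e t"
        by (simp add: algebra_simps)
      finally show "((\<lambda>t. \<i> * k * (C k t * e t) + q t * (A k t * e t)) has_vector_derivative
         q' t * A k t * e t + q t * cnj (q t) * C k t * e t) (at t within {\<alpha>..\<beta>})" .
      have "norm (q' t * A k t * e t + q t * cnj (q t) * C k t * e t)
         \<le> norm (q' t) * norm (A k t) + norm (q t) * norm (q t) * norm (C k t)"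
        by (intro order_trans[OF norm_triangle_ineq] add_mono) (auto simp: norm_mult ne)
      also have "\<dots> \<le> Q * M + qmax * qmax * M"
        using norm_q_le[OF t] A_le[OF t k] C_le[OF t k] Q(1)[OF t] Q(2) qmax_nonneg M0
        by (intro add_mono mult_mono) auto
      finally show "norm (q' t * A k t * e t + q t * cnj (q t) * C k t * e t) \<le> Q * M + qmax * qmax * M" .
    qed (use less in auto)
    then have 1: "norm ((\<i> * k * (C k \<beta> * e \<beta>) + q \<beta> * (A k \<beta> * e \<beta>)) - q \<alpha> * e \<alpha>)
        \<le> (Q * M + qmax * qmax * M) * (\<beta> - \<alpha>)"
      by (simp add: AC_start)
    have b: "\<beta> \<in> {\<alpha>..\<beta>}" "\<alpha> \<in> {\<alpha>..\<beta>}" using less by auto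
    have 2: "norm (q \<beta> * (A k \<beta> * e \<beta>)) \<le> qmax * M"
      using norm_q_le[OF b(1)] A_le[OF b(1) k] qmax_nonneg by (auto simp: norm_mult ne intro!: mult_mono)
    have 3: "norm (q \<alpha> * e \<alpha>) \<le> qmax"
      using norm_q_le[OF b(2)] by (auto simp: norm_mult ne)
    let ?X = "\<i> * k * (C k \<beta> * e \<beta>)" and ?Y = "q \<beta> * (A k \<beta> * e \<beta>)" and ?Z = "q \<alpha> * e \<alpha>"
    have "?X = ((?X + ?Y) - ?Z) + (?Z - ?Y)" by (simp add: algebra_simps)
    then have "norm ?X \<le> norm ((?X + ?Y) - ?Z) + norm (?Z - ?Y)" by (metis norm_triangle_ineq)
    also have "norm (?Z - ?Y) \<le> norm ?Z + norm ?Y" by (rule norm_triangle_ineq4)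
    finally have "norm ?X \<le> ?K" using 1 2 3 by linarith
    then show "norm k * norm (C k \<beta>) \<le> ?K" by (simp add: norm_mult ne)
  next
    show "?K \<ge> 0" using qmax_nonneg Q less M0 by auto
  qed
qed

end

section \<open>Scattering data of a truncated potential\<close>

definition mat2 :: "complex \<Rightarrow> complex \<Rightarrow> complex \<Rightarrow> complex \<Rightarrow> complex^2^2" where
  "mat2 a b c d = vector [vector [a, b], vector [c, d]]"

lemma mat2_nth [simp]:
  "mat2 a b c d $ 1 $ 1 = a" "mat2 a b c d $ 1 $ 2 = b"
  "mat2 a b c d $ 2 $ 1 = c" "mat2 a b c d $ 2 $ 2 = d"
  by (simp_all add: mat2_def)

lemma mat2_eq_iff:
  "M = mat2 a b c d \<longleftrightarrow> M $ 1 $ 1 = a \<and> M $ 1 $ 2 = b \<and> M $ 2 $ 1 = c \<and> M $ 2 $ 2 = d"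
  unfolding vec_eq_iff forall_2 mat2_nth by (rule conj_assoc)

lemma matrix2_eq_iff:
  fixes M N :: "complex^2^2"
  shows "M = N \<longleftrightarrow> M $ 1 $ 1 = N $ 1 $ 1 \<and> M $ 1 $ 2 = N $ 1 $ 2 \<and> M $ 2 $ 1 = N $ 2 $ 1 \<and> M $ 2 $ 2 = N $ 2 $ 2"
  unfolding vec_eq_iff forall_2 mat2_nth by (rule conj_assoc)

lemma matrix2_mult_nth:
  fixes M N :: "complex^2^2"
  shows "(M ** N) $ i $ j = M $ i $ 1 * N $ 1 $ j + M $ i $ 2 * N $ 2 $ j"
  by (simp add: matrix_matrix_mult_def sum_2)

lemma mat2_one: "mat 1 = mat2 1 0 0 1"
  by (simp add: mat2_eq_iff mat_def)

lemma mat2_sum: "mat2 a b c d = mat2 a 0 0 0 + mat2 0 b 0 0 + mat2 0 0 c 0 + mat2 0 0 0 d"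
  by (simp add: matrix2_eq_iff)

lemma bounded_linear_mat2:
  "bounded_linear (\<lambda>z. mat2 z 0 0 0)" "bounded_linear (\<lambda>z. mat2 0 z 0 0)"
  "bounded_linear (\<lambda>z. mat2 0 0 z 0)" "bounded_linear (\<lambda>z. mat2 0 0 0 z)"
  unfolding linear_conv_bounded_linear[symmetric]
  by (auto intro!: linearI simp: matrix2_eq_iff)

lemma has_vector_derivative_mat2:
  assumes "(a has_vector_derivative a') F" "(b has_vector_derivative b') F"
    "(c has_vector_derivative c') F" "(d has_vector_derivative d') F"
  shows "((\<lambda>x. mat2 (a x) (b x) (c x) (d x)) has_vector_derivative mat2 a' b' c' d') F"
  by (subst mat2_sum, subst (2) mat2_sum)
     (intro has_vector_derivative_add assms[THEN bounded_linear.has_vector_derivative[rotated]] bounded_linear_mat2)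

lemma continuous_on_mat2:
  assumes "continuous_on S a" "continuous_on S b" "continuous_on S c" "continuous_on S d"
  shows "continuous_on S (\<lambda>x. mat2 (a x) (b x) (c x) (d x))"
  by (subst mat2_sum)
     (intro continuous_on_add assms[THEN bounded_linear.continuous_on[rotated]] bounded_linear_mat2)

lemma has_vector_derivative_vec_nth:
  "(T has_vector_derivative T') F \<Longrightarrow> ((\<lambda>x. T x $ i) has_vector_derivative T' $ i) F"
  by (rule bounded_linear.has_vector_derivative[OF bounded_linear_vec_nth])

lemma continuous_on_matrix2_mult:
  fixes S T :: "real \<Rightarrow> complex^2^2"
  assumes "continuous_on X S" "continuous_on X T"
  shows "continuous_on X (\<lambda>x. S x ** T x)"
proof -
  have "(\<lambda>x. S x ** T x) = (\<lambda>x. mat2 ((S x ** T x) $ 1 $ 1) ((S x ** T x) $ 1 $ 2) ((S x ** T x) $ 2 $ 1) ((S x ** T x) $ 2 $ 2))"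
    by (auto simp: mat2_eq_iff)
  then show ?thesis
    unfolding matrix2_mult_nth
    by (simp only:) (intro continuous_on_mat2 continuous_intros assms)
qed

lemma has_vector_derivative_matrix2_mult:
  fixes S T :: "real \<Rightarrow> complex^2^2"
  assumes "(S has_vector_derivative S') (at x within X)" "(T has_vector_derivative T') (at x within X)"
  shows "((\<lambda>x. S x ** T x) has_vector_derivative S' ** T x + S x ** T') (at x within X)"
proof -
  have expand: "M ** N = mat2 (M $ 1 $ 1 * N $ 1 $ 1 + M $ 1 $ 2 * N $ 2 $ 1) (M $ 1 $ 1 * N $ 1 $ 2 + M $ 1 $ 2 * N $ 2 $ 2)
      (M $ 2 $ 1 * N $ 1 $ 1 + M $ 2 $ 2 * N $ 2 $ 1) (M $ 2 $ 1 * N $ 1 $ 2 + M $ 2 $ 2 * N $ 2 $ 2)" for M N :: "complex^2^2"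
    by (simp add: matrix2_eq_iff matrix2_mult_nth)
  note nth = has_vector_derivative_vec_nth[OF has_vector_derivative_vec_nth]
  have "((\<lambda>x. S x ** T x) has_vector_derivative mat2
      ((S x $ 1 $ 1 * T' $ 1 $ 1 + S' $ 1 $ 1 * T x $ 1 $ 1) + (S x $ 1 $ 2 * T' $ 2 $ 1 + S' $ 1 $ 2 * T x $ 2 $ 1))
      ((S x $ 1 $ 1 * T' $ 1 $ 2 + S' $ 1 $ 1 * T x $ 1 $ 2) + (S x $ 1 $ 2 * T' $ 2 $ 2 + S' $ 1 $ 2 * T x $ 2 $ 2))
      ((S x $ 2 $ 1 * T' $ 1 $ 1 + S' $ 2 $ 1 * T x $ 1 $ 1) + (S x $ 2 $ 2 * T' $ 2 $ 1 + S' $ 2 $ 2 * T x $ 2 $ 1))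
      ((S x $ 2 $ 1 * T' $ 1 $ 2 + S' $ 2 $ 1 * T x $ 1 $ 2) + (S x $ 2 $ 2 * T' $ 2 $ 2 + S' $ 2 $ 2 * T x $ 2 $ 2)))
      (at x within X)"
    unfolding expand
    by (intro has_vector_derivative_mat2 has_vector_derivative_add has_vector_derivative_mult nth assms)
  also have "mat2
      ((S x $ 1 $ 1 * T' $ 1 $ 1 + S' $ 1 $ 1 * T x $ 1 $ 1) + (S x $ 1 $ 2 * T' $ 2 $ 1 + S' $ 1 $ 2 * T x $ 2 $ 1))
      ((S x $ 1 $ 1 * T' $ 1 $ 2 + S' $ 1 $ 1 * T x $ 1 $ 2) + (S x $ 1 $ 2 * T' $ 2 $ 2 + S' $ 1 $ 2 * T x $ 2 $ 2))
      ((S x $ 2 $ 1 * T' $ 1 $ 1 + S' $ 2 $ 1 * T x $ 1 $ 1) + (S x $ 2 $ 2 * T' $ 2 $ 1 + S' $ 2 $ 2 * T x $ 2 $ 1))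
      ((S x $ 2 $ 1 * T' $ 1 $ 2 + S' $ 2 $ 1 * T x $ 1 $ 2) + (S x $ 2 $ 2 * T' $ 2 $ 2 + S' $ 2 $ 2 * T x $ 2 $ 2))
      = S' ** T x + S x ** T'"
    by (simp add: matrix2_eq_iff matrix2_mult_nth)
  finally show ?thesis .
qed

lemma matrix2_zero [simp]: "M ** (0 :: complex^2^2) = 0" "(0 :: complex^2^2) ** M = 0"
  by (simp_all add: matrix2_eq_iff matrix2_mult_nth)

lemma matrix2_diff_distrib:
  fixes E M N :: "complex^2^2"
  shows "E ** (M - N) = E ** M - E ** N"
  by (simp add: matrix2_eq_iff matrix2_mult_nth algebra_simps)

text \<open>The hypothesis says that the determinant is 1, so the adjugate is a two-sided
  inverse.\<close>

lemma mat2_det_inverse: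
  assumes "a * cnj a - b * cnj b = 1"
  shows "mat2 (cnj a) (- cnj b) (- b) a ** mat2 a (cnj b) b (cnj a) = mat 1"
    and "mat2 a (cnj b) b (cnj a) ** mat2 (cnj a) (- cnj b) (- b) a = mat 1"
  using assms by (auto simp: matrix2_eq_iff matrix2_mult_nth mat2_one algebra_simps)

section \<open>The Dirac equation as a first-order system\<close>

definition dirac_matrix :: "(real \<Rightarrow> complex) \<Rightarrow> real \<Rightarrow> real \<Rightarrow> complex^2^2" where
  "dirac_matrix q \<xi> x = mat2 (- \<i> * \<xi> / 2) (cnj (q x)) (q x) (\<i> * \<xi> / 2)"

text \<open>Multiplication by \<open>- \<i> * sigma3\<close>, the inverse of the leading
  coefficient, solves the eigenvalue equation for the derivative.\<close>

lemma dirac_op_eq_iff: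
  "dirac_op q T T' x = mscale (of_real \<xi> / 2) (T x) \<longleftrightarrow> T' x = dirac_matrix q \<xi> x ** T x"
proof -
  have row1: "\<i> * t' - \<i> * (c * t2) = r * t1 \<longleftrightarrow> t' = - (\<i> * r * t1) + c * t2" for t' t1 t2 c r :: complex
    by (auto simp: algebra_simps complex_eq_iff)
  have row2: "\<i> * (c * t1) - \<i> * t' = r * t2 \<longleftrightarrow> t' = c * t1 + \<i> * r * t2" for t' t1 t2 c r :: complex
    by (auto simp: algebra_simps complex_eq_iff)
  show ?thesis
    using row1[of _ "cnj (q x)" _ "of_real \<xi> / 2"] row2[of "q x" _ _ "of_real \<xi> / 2"]
    by (simp add: matrix2_eq_iff dirac_op_def mscale_def matrix2_mult_nth dirac_matrix_def
        sigma3_def sigma_plus_def sigma_minus_def)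
qed

lemma free_solution_eq:
  "free_solution x \<xi> = mat2 (exp (- (\<i> * of_real \<xi> * of_real x / 2))) 0 0 (exp (\<i> * of_real \<xi> * of_real x / 2))"
  by (simp add: free_solution_def mat2_def complex_eq_iff Re_divide Im_divide)

lemma free_solution_inverse: "free_solution (- x) \<xi> ** free_solution x \<xi> = mat 1"
  by (simp add: free_solution_eq matrix2_eq_iff matrix2_mult_nth mat2_one flip: exp_add)

text \<open>For real \<xi> the diagonal entries of the free solution have modulus 1, so the moduli
  of the entries of the product do not depend on \<open>x\<close>. Uniqueness of both Jost solutions
  rests on this.\<close>

lemma free_solution_mult_tendsto_0:
  fixes N :: "complex^2^2"
  assumes "((\<lambda>x. free_solution x \<xi> ** N) \<longlongrightarrow> 0) G" "G \<noteq> bot"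
  shows "N = 0"
proof -
  have "N $ i $ j = 0" if "i = 1 \<or> i = 2" for i j :: 2
  proof -
    have "((\<lambda>x. norm ((free_solution x \<xi> ** N) $ i $ j)) \<longlongrightarrow> norm ((0 :: complex^2^2) $ i $ j)) G"
      by (intro tendsto_norm tendsto_vec_nth assms(1))
    moreover have "norm ((free_solution x \<xi> ** N) $ i $ j) = norm (N $ i $ j)" for x
      using that by (auto simp: free_solution_eq matrix2_mult_nth norm_mult)
    ultimately show ?thesis
      using assms(2) by (simp add: tendsto_const_iff)
  qed
  then show ?thesis by (simp add: matrix2_eq_iff)
qed

section \<open>Jost solutions and scattering matrix of the truncated potential\<close>

context dirac_potential
begin

definition clip :: "real \<Rightarrow> real" where "clip x = max \<alpha> (min \<beta> x)"

lemma clip: "clip x \<in> {\<alpha>..\<beta>}" "x \<le> \<alpha> \<Longrightarrow> clip x = \<alpha>" "x \<ge> \<beta> \<Longrightarrow> clip x = \<beta>" "x \<in> {\<alpha>..\<beta>} \<Longrightarrow> clip x = x"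
  using less unfolding clip_def by auto

abbreviation q\<^sub>t :: "real \<Rightarrow> complex" where "q\<^sub>t \<equiv> truncation q \<alpha> \<beta>"

text \<open>Outside the support the coefficients in the free basis are constant; composing with
  \<open>clip\<close> extends them to the whole line. The exponential in \<open>B\<^sub>t\<close>
  undoes the normalisation of \<open>C\<close>.\<close>

definition A\<^sub>t :: "real \<Rightarrow> real \<Rightarrow> complex" where "A\<^sub>t \<xi> x = A (of_real \<xi>) (clip x)"
definition B\<^sub>t :: "real \<Rightarrow> real \<Rightarrow> complex" where
  "B\<^sub>t \<xi> x = exp (- (\<i> * of_real \<xi>) * of_real (clip x)) * C (of_real \<xi>) (clip x)"

lemma continuous_AB\<^sub>t: "continuous_on S (A\<^sub>t \<xi>)" "continuous_on S (B\<^sub>t \<xi>)"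
proof -
  have p: "continuous_on S clip" "clip ` S \<subseteq> {\<alpha>..\<beta>}"
    unfolding clip_def using less by (auto intro!: continuous_intros)
  show "continuous_on S (A\<^sub>t \<xi>)" "continuous_on S (B\<^sub>t \<xi>)"
    unfolding A\<^sub>t_def[abs_def] B\<^sub>t_def[abs_def]
    using continuous_on_compose2[OF continuous_AC_snd(1)[OF order_refl] p]
      continuous_on_compose2[OF continuous_AC_snd(2)[OF order_refl] p]
    by (auto intro!: continuous_intros p)
qed

lemma det_AB\<^sub>t: "A\<^sub>t \<xi> x * cnj (A\<^sub>t \<xi> x) - B\<^sub>t \<xi> x * cnj (B\<^sub>t \<xi> x) = 1"
proof -
  have n: "norm (B\<^sub>t \<xi> x) = norm (C (of_real \<xi>) (clip x))" by (simp add: B\<^sub>t_def norm_mult)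
  have "(norm (A\<^sub>t \<xi> x))\<^sup>2 = 1 + (norm (B\<^sub>t \<xi> x))\<^sup>2"
    unfolding n unfolding A\<^sub>t_def by (rule energy_eq[OF clip(1)]) simp
  then show ?thesis
    by (simp flip: complex_norm_square)
qed

lemma deriv_AB\<^sub>t:
  assumes x: "x \<notin> {\<alpha>, \<beta>}"
  shows "(A\<^sub>t \<xi> has_vector_derivative cnj (q\<^sub>t x) * exp (\<i> * of_real \<xi> * of_real x) * B\<^sub>t \<xi> x) (at x)"
    and "(B\<^sub>t \<xi> has_vector_derivative q\<^sub>t x * exp (- (\<i> * of_real \<xi>) * of_real x) * A\<^sub>t \<xi> x) (at x)"
proof -
  let ?k = "of_real \<xi> :: complex"
  let ?PA = "(A\<^sub>t \<xi> has_vector_derivative cnj (q\<^sub>t x) * exp (\<i> * of_real \<xi> * of_real x) * B\<^sub>t \<xi> x) (at x)"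
  let ?PB = "(B\<^sub>t \<xi> has_vector_derivative q\<^sub>t x * exp (- (\<i> * of_real \<xi>) * of_real x) * A\<^sub>t \<xi> x) (at x)"
  have "?PA \<and> ?PB"
  proof (cases "x \<in> {\<alpha><..<\<beta>}")
    case True
    then have at: "at x within {\<alpha>..\<beta>} = at x" by (intro at_within_interior) (auto simp: interior_atLeastAtMost_real)
    have d: "(A ?k has_vector_derivative cnj (q x) * C ?k x) (at x)"
      "(C ?k has_vector_derivative \<i> * ?k * C ?k x + q x * A ?k x) (at x)"
      using deriv_AC[of x ?k] True unfolding at by auto
    have px: "clip x = x" and qx: "q\<^sub>t x = q x" using True by (auto simp: clip truncation_def)
    have A: "(A\<^sub>t \<xi> has_vector_derivative cnj (q x) * C ?k x) (at x)"
      by (rule has_vector_derivative_transform_within_open[OF d(1) open_greaterThanLessThan True])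
         (auto simp: A\<^sub>t_def clip)
    have "cnj (q x) * C ?k x = cnj (q\<^sub>t x) * exp (\<i> * of_real \<xi> * of_real x) * B\<^sub>t \<xi> x"
      unfolding qx B\<^sub>t_def px by (simp add: mult.assoc flip: exp_add)
    with A have PA: ?PA by simp
    have "((\<lambda>x. exp (- (\<i> * of_real \<xi>) * of_real x) * C ?k x) has_vector_derivative
       exp (- (\<i> * of_real \<xi>) * of_real x) * (\<i> * ?k * C ?k x + q x * A ?k x)
       + - (\<i> * of_real \<xi>) * exp (- (\<i> * of_real \<xi>) * of_real x) * C ?k x) (at x)"
      by (intro has_vector_derivative_mult d has_vector_derivative_exp_linear)
    then have "(B\<^sub>t \<xi> has_vector_derivative exp (- (\<i> * of_real \<xi>) * of_real x) * (\<i> * ?k * C ?k x + q x * A ?k x)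
       + - (\<i> * of_real \<xi>) * exp (- (\<i> * of_real \<xi>) * of_real x) * C ?k x) (at x)"
      by (rule has_vector_derivative_transform_within_open[OF _ open_greaterThanLessThan True])
         (auto simp: B\<^sub>t_def clip)
    then have PB: ?PB
      unfolding qx A\<^sub>t_def px by (simp add: algebra_simps)
    from PA PB show ?thesis ..
  next
    case False
    with x consider "x < \<alpha>" | "x > \<beta>" by fastforce
    then obtain U c where U: "open U" "x \<in> U" "\<And>y. y \<in> U \<Longrightarrow> clip y = c"
    proof cases
      case 1
      then show ?thesis using that[of "{..<\<alpha>}" \<alpha>] clip(2) by auto
    next
      case 2
      then show ?thesis using that[of "{\<beta><..}" \<beta>] clip(3) by auto
    qed
    have "(A\<^sub>t \<xi> has_vector_derivative 0) (at x)" "(B\<^sub>t \<xi> has_vector_derivative 0) (at x)"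
      by (rule has_vector_derivative_transform_within_open[OF has_vector_derivative_const U(1,2)],
          simp add: A\<^sub>t_def B\<^sub>t_def U(3))+
    moreover have "q\<^sub>t x = 0" using False x by (auto simp: truncation_def indicator_def)
    ultimately show ?thesis by simp
  qed
  then show ?PA ?PB by auto
qed

text \<open>This is the Jost solution from the left, as \<open>jost_minus_iff\<close> will show. Its
  second column comes from the first by the symmetry of the equation for real \<xi>: conjugate and
  exchange the entries.\<close>

definition \<Phi> :: "real \<Rightarrow> real \<Rightarrow> complex^2^2" where
  "\<Phi> \<xi> x = free_solution x \<xi> ** mat2 (A\<^sub>t \<xi> x) (cnj (B\<^sub>t \<xi> x)) (B\<^sub>t \<xi> x) (cnj (A\<^sub>t \<xi> x))"

text \<open>The inverse of \<Phi>, written through the adjugate so that its own differential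
  equation can be computed entrywise. It serves to show that the product of \<open>\<Psi>\<close>
  with any solution is constant.\<close>

definition \<Psi> :: "real \<Rightarrow> real \<Rightarrow> complex^2^2" where
  "\<Psi> \<xi> x = mat2 (cnj (A\<^sub>t \<xi> x)) (- cnj (B\<^sub>t \<xi> x)) (- B\<^sub>t \<xi> x) (A\<^sub>t \<xi> x) ** free_solution (- x) \<xi>"

lemma \<Psi>_\<Phi>: "\<Psi> \<xi> x ** \<Phi> \<xi> x = mat 1"
proof -
  have "\<Psi> \<xi> x ** \<Phi> \<xi> x = mat2 (cnj (A\<^sub>t \<xi> x)) (- cnj (B\<^sub>t \<xi> x)) (- B\<^sub>t \<xi> x) (A\<^sub>t \<xi> x) **
     ((free_solution (- x) \<xi> ** free_solution x \<xi>) ** mat2 (A\<^sub>t \<xi> x) (cnj (B\<^sub>t \<xi> x)) (B\<^sub>t \<xi> x) (cnj (A\<^sub>t \<xi> x)))"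
    by (simp add: \<Phi>_def \<Psi>_def matrix_mul_assoc)
  then show ?thesis
    by (simp add: free_solution_inverse mat2_det_inverse det_AB\<^sub>t)
qed

lemma \<Phi>_\<Psi>: "\<Phi> \<xi> x ** \<Psi> \<xi> x = mat 1"
  using \<Psi>_\<Phi> matrix_left_right_inverse by blast

lemma \<Phi>_eq: "\<Phi> \<xi> x = mat2
    (exp (- (\<i> * \<xi> / 2) * of_real x) * A\<^sub>t \<xi> x) (exp (- (\<i> * \<xi> / 2) * of_real x) * cnj (B\<^sub>t \<xi> x))
    (exp (\<i> * \<xi> / 2 * of_real x) * B\<^sub>t \<xi> x) (exp (\<i> * \<xi> / 2 * of_real x) * cnj (A\<^sub>t \<xi> x))"
  by (simp add: \<Phi>_def free_solution_eq matrix2_eq_iff matrix2_mult_nth)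

lemma \<Psi>_eq: "\<Psi> \<xi> x = mat2
    (exp (\<i> * \<xi> / 2 * of_real x) * cnj (A\<^sub>t \<xi> x)) (- (exp (- (\<i> * \<xi> / 2) * of_real x) * cnj (B\<^sub>t \<xi> x)))
    (- (exp (\<i> * \<xi> / 2 * of_real x) * B\<^sub>t \<xi> x)) (exp (- (\<i> * \<xi> / 2) * of_real x) * A\<^sub>t \<xi> x)"
  by (simp add: \<Psi>_def free_solution_eq matrix2_eq_iff matrix2_mult_nth)

lemma continuous_\<Phi>: "continuous_on S (\<Phi> \<xi>)"
  unfolding \<Phi>_eq[abs_def] by (intro continuous_on_mat2 continuous_intros continuous_AB\<^sub>t)

lemma continuous_\<Psi>: "continuous_on S (\<Psi> \<xi>)"
  unfolding \<Psi>_eq[abs_def] by (intro continuous_on_mat2 continuous_intros continuous_AB\<^sub>t)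

lemma deriv_\<Phi>\<Psi>:
  assumes x: "x \<notin> {\<alpha>, \<beta>}"
  shows "(\<Phi> \<xi> has_vector_derivative dirac_matrix q\<^sub>t \<xi> x ** \<Phi> \<xi> x) (at x)"
    and "(\<Psi> \<xi> has_vector_derivative - (\<Psi> \<xi> x ** dirac_matrix q\<^sub>t \<xi> x)) (at x)"
proof -
  define p where "p = exp (\<i> * \<xi> / 2 * of_real x)"
  define m where "m = exp (- (\<i> * \<xi> / 2) * of_real x)"
  have pm: "p * m = 1" by (simp add: p_def m_def flip: exp_add)
  have pp: "exp (\<i> * of_real \<xi> * of_real x) = p * p" by (simp add: p_def field_simps flip: exp_add)
  have mm: "exp (- (\<i> * of_real \<xi>) * of_real x) = m * m" by (simp add: m_def field_simps flip: exp_add)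
  note dA = deriv_AB\<^sub>t(1)[OF x, of \<xi>, unfolded pp] and dB = deriv_AB\<^sub>t(2)[OF x, of \<xi>, unfolded mm]
  have pm': "m * (p * y) = y" "p * (m * y) = y" for y
    using pm by (metis mult.assoc mult.commute mult_1)+
  have cnj_p: "cnj p = m" "cnj m = p" by (simp_all add: p_def m_def exp_cnj)
  have c1: "m * (c * (p * p) * b) + - (\<i> * \<xi> / 2) * m * a = - \<i> * \<xi> / 2 * (m * a) + c * (p * b)"
    and c2: "p * (c * (m * m) * b) + \<i> * \<xi> / 2 * p * a = c * (m * b) + \<i> * \<xi> / 2 * (p * a)" for c b a
    using pm by (auto simp: algebra_simps pm')
  have "(\<Phi> \<xi> has_vector_derivative mat2
      (m * (cnj (q\<^sub>t x) * (p * p) * B\<^sub>t \<xi> x) + - (\<i> * \<xi> / 2) * m * A\<^sub>t \<xi> x)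
      (m * cnj (q\<^sub>t x * (m * m) * A\<^sub>t \<xi> x) + - (\<i> * \<xi> / 2) * m * cnj (B\<^sub>t \<xi> x))
      (p * (q\<^sub>t x * (m * m) * A\<^sub>t \<xi> x) + \<i> * \<xi> / 2 * p * B\<^sub>t \<xi> x)
      (p * cnj (cnj (q\<^sub>t x) * (p * p) * B\<^sub>t \<xi> x) + \<i> * \<xi> / 2 * p * cnj (A\<^sub>t \<xi> x))) (at x)"
    unfolding \<Phi>_eq[abs_def] p_def m_def
    by (intro has_vector_derivative_mat2 has_vector_derivative_mult has_vector_derivative_cnj
        dA[unfolded p_def] dB[unfolded m_def] has_vector_derivative_exp_linear)
  also have "mat2
      (m * (cnj (q\<^sub>t x) * (p * p) * B\<^sub>t \<xi> x) + - (\<i> * \<xi> / 2) * m * A\<^sub>t \<xi> x)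
      (m * cnj (q\<^sub>t x * (m * m) * A\<^sub>t \<xi> x) + - (\<i> * \<xi> / 2) * m * cnj (B\<^sub>t \<xi> x))
      (p * (q\<^sub>t x * (m * m) * A\<^sub>t \<xi> x) + \<i> * \<xi> / 2 * p * B\<^sub>t \<xi> x)
      (p * cnj (cnj (q\<^sub>t x) * (p * p) * B\<^sub>t \<xi> x) + \<i> * \<xi> / 2 * p * cnj (A\<^sub>t \<xi> x))
    = dirac_matrix q\<^sub>t \<xi> x ** \<Phi> \<xi> x"
    unfolding \<Phi>_eq p_def[symmetric] m_def[symmetric] complex_cnj_mult complex_cnj_cnj cnj_p c1 c2
    by (simp add: matrix2_eq_iff matrix2_mult_nth dirac_matrix_def)
  finally show "(\<Phi> \<xi> has_vector_derivative dirac_matrix q\<^sub>t \<xi> x ** \<Phi> \<xi> x) (at x)" .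
  have "(\<Psi> \<xi> has_vector_derivative mat2
      (p * cnj (cnj (q\<^sub>t x) * (p * p) * B\<^sub>t \<xi> x) + \<i> * \<xi> / 2 * p * cnj (A\<^sub>t \<xi> x))
      (- (m * cnj (q\<^sub>t x * (m * m) * A\<^sub>t \<xi> x) + - (\<i> * \<xi> / 2) * m * cnj (B\<^sub>t \<xi> x)))
      (- (p * (q\<^sub>t x * (m * m) * A\<^sub>t \<xi> x) + \<i> * \<xi> / 2 * p * B\<^sub>t \<xi> x))
      (m * (cnj (q\<^sub>t x) * (p * p) * B\<^sub>t \<xi> x) + - (\<i> * \<xi> / 2) * m * A\<^sub>t \<xi> x)) (at x)"
    unfolding \<Psi>_eq[abs_def] p_def m_def
    by (intro has_vector_derivative_mat2 has_vector_derivative_minus has_vector_derivative_mult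
        has_vector_derivative_cnj dA[unfolded p_def] dB[unfolded m_def] has_vector_derivative_exp_linear)
  also have "mat2
      (p * cnj (cnj (q\<^sub>t x) * (p * p) * B\<^sub>t \<xi> x) + \<i> * \<xi> / 2 * p * cnj (A\<^sub>t \<xi> x))
      (- (m * cnj (q\<^sub>t x * (m * m) * A\<^sub>t \<xi> x) + - (\<i> * \<xi> / 2) * m * cnj (B\<^sub>t \<xi> x)))
      (- (p * (q\<^sub>t x * (m * m) * A\<^sub>t \<xi> x) + \<i> * \<xi> / 2 * p * B\<^sub>t \<xi> x))
      (m * (cnj (q\<^sub>t x) * (p * p) * B\<^sub>t \<xi> x) + - (\<i> * \<xi> / 2) * m * A\<^sub>t \<xi> x)
    = - (\<Psi> \<xi> x ** dirac_matrix q\<^sub>t \<xi> x)"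
    unfolding \<Psi>_eq p_def[symmetric] m_def[symmetric] complex_cnj_mult complex_cnj_cnj cnj_p c1 c2
    by (simp add: matrix2_eq_iff matrix2_mult_nth dirac_matrix_def)
  finally show "(\<Psi> \<xi> has_vector_derivative - (\<Psi> \<xi> x ** dirac_matrix q\<^sub>t \<xi> x)) (at x)" .
qed

text \<open>Isolates the jumps at the ends of the support in one indicator factor; the two matrices
  that remain are continuous on the whole line.\<close>

lemma dirac_matrix_split:
  fixes M :: "complex^2^2"
  shows "dirac_matrix q\<^sub>t \<xi> x ** M = dirac_matrix (\<lambda>_. 0) \<xi> x ** M +
     indicator {\<alpha>..\<beta>} x *\<^sub>R (mat2 0 (cnj (q x)) (q x) 0 ** M)"
proof (cases "x \<in> {\<alpha>..\<beta>}")
  case True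
  then have "q\<^sub>t x = q x" "indicator {\<alpha>..\<beta>} x = (1 :: real)" by (auto simp: truncation_def)
  then show ?thesis by (simp add: matrix2_eq_iff matrix2_mult_nth dirac_matrix_def algebra_simps)
next
  case False
  then have "q\<^sub>t x = 0" "indicator {\<alpha>..\<beta>} x = (0 :: real)" by (auto simp: truncation_def)
  then show ?thesis by (simp add: dirac_matrix_def)
qed

lemma continuous_split:
  fixes T :: "real \<Rightarrow> complex^2^2"
  assumes "continuous_on UNIV T"
  shows "continuous_on UNIV (\<lambda>x. dirac_matrix (\<lambda>_. 0) \<xi> x ** T x)"
    "continuous_on UNIV (\<lambda>x. mat2 0 (cnj (q x)) (q x) 0 ** T x)"
  unfolding dirac_matrix_def
  by (rule continuous_on_matrix2_mult, intro continuous_on_mat2 continuous_on_const continuous_on_cnj cont_q, rule assms)+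

lemma dirac_matrix_integrable:
  fixes T :: "real \<Rightarrow> complex^2^2"
  assumes "continuous_on UNIV T"
  shows "(\<lambda>x. dirac_matrix q\<^sub>t \<xi> x ** T x) absolutely_integrable_on {a..b}"
proof -
  have ind: "(\<lambda>x. indicator {\<alpha>..\<beta>} x *\<^sub>R f x) absolutely_integrable_on {a..b}"
    if "continuous_on UNIV f" for f :: "real \<Rightarrow> complex^2^2"
  proof -
    have "f absolutely_integrable_on {a..b}"
      by (intro absolutely_integrable_continuous_real continuous_on_subset[OF that]) auto
    then have "integrable lebesgue (\<lambda>x. indicator {\<alpha>..\<beta>} x *\<^sub>R (indicator {a..b} x *\<^sub>R f x))"
      unfolding set_integrable_def by (rule integrable_mult_indicator[rotated]) simp
    moreover have "indicator {\<alpha>..\<beta>} x *\<^sub>R (indicator {a..b} x *\<^sub>R f x) =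
        (indicator {a..b} x :: real) *\<^sub>R (indicator {\<alpha>..\<beta>} x :: real) *\<^sub>R f x" for x
      by (simp only: scaleR_scaleR mult.commute)
    ultimately show ?thesis unfolding set_integrable_def by (simp only:)
  qed
  show ?thesis
    unfolding dirac_matrix_split
    by (intro set_integral_add ind continuous_split assms absolutely_integrable_continuous_real
        continuous_on_subset[OF continuous_split(1)[OF assms]]) auto
qed

lemma dirac_matrix_continuous_at:
  fixes T :: "real \<Rightarrow> complex^2^2"
  assumes T: "continuous_on UNIV T" and x: "x \<notin> {\<alpha>, \<beta>}"
  shows "isCont (\<lambda>x. dirac_matrix q\<^sub>t \<xi> x ** T x) x"
proof -
  have "\<exists>U c. open U \<and> x \<in> U \<and> (\<forall>y\<in>U. indicator {\<alpha>..\<beta>} y = (c :: real))"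
  proof -
    consider "x < \<alpha>" | "\<alpha> < x" "x < \<beta>" | "x > \<beta>" using x by fastforce
    then show ?thesis
    proof cases
      case 1
      then show ?thesis by (intro exI[of _ "{..<\<alpha>}"] exI[of _ 0]) auto
    next
      case 2
      then show ?thesis by (intro exI[of _ "{\<alpha><..<\<beta>}"] exI[of _ 1]) auto
    next
      case 3
      then show ?thesis by (intro exI[of _ "{\<beta><..}"] exI[of _ 0]) auto
    qed
  qed
  then obtain U and c :: real where U: "open U" "x \<in> U" "\<And>y. y \<in> U \<Longrightarrow> indicator {\<alpha>..\<beta>} y = c" by blast
  have "continuous_on U (\<lambda>x. dirac_matrix (\<lambda>_. 0) \<xi> x ** T x + c *\<^sub>R (mat2 0 (cnj (q x)) (q x) 0 ** T x))"
    by (intro continuous_intros continuous_on_subset[OF continuous_split(1)[OF T]]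
        continuous_on_subset[OF continuous_split(2)[OF T]]) auto
  then have "continuous_on U (\<lambda>x. dirac_matrix q\<^sub>t \<xi> x ** T x)"
    by (subst continuous_on_cong[OF refl]) (simp_all add: dirac_matrix_split U(3))
  then show ?thesis using U(1,2) by (simp add: continuous_on_eq_continuous_at)
qed

text \<open>From right to left, the fundamental theorem of calculus with the two ends of the support
  as exceptional points. Conversely, a solution in the almost-everywhere sense is continuous, so the
  right-hand side of its equation is continuous off these points and the solution is classically
  differentiable there. Then \<Psi> T is continuous with zero derivative off a finite set, hence
  constant.\<close>

lemma dirac_solution_iff: "dirac_solution q\<^sub>t \<xi> T \<longleftrightarrow> (\<exists>K. T = (\<lambda>x. \<Phi> \<xi> x ** K))"
proof
  assume "\<exists>K. T = (\<lambda>x. \<Phi> \<xi> x ** K)"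
  then obtain K where T: "T = (\<lambda>x. \<Phi> \<xi> x ** K)" by blast
  have contT: "continuous_on S T" for S
    unfolding T by (intro continuous_on_matrix2_mult continuous_\<Phi> continuous_on_const)
  have derivT: "(T has_vector_derivative dirac_matrix q\<^sub>t \<xi> x ** T x) (at x)" if "x \<notin> {\<alpha>, \<beta>}" for x
    using has_vector_derivative_matrix2_mult[OF deriv_\<Phi>\<Psi>(1)[OF that] has_vector_derivative_const[of K]]
    by (simp add: T matrix_mul_assoc matrix2_zero)
  have "loc_abs_cont_deriv T (\<lambda>x. dirac_matrix q\<^sub>t \<xi> x ** T x)"
    unfolding loc_abs_cont_deriv_def
  proof (intro allI impI conjI)
    fix x y :: real assume "x \<le> y"
    show "(\<lambda>x. dirac_matrix q\<^sub>t \<xi> x ** T x) absolutely_integrable_on {x..y}"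
      by (rule dirac_matrix_integrable[OF contT])
    have "((\<lambda>x. dirac_matrix q\<^sub>t \<xi> x ** T x) has_integral (T y - T x)) {x..y}"
      by (rule fundamental_theorem_of_calculus_strong[of "{\<alpha>, \<beta>}"])
         (use \<open>x \<le> y\<close> contT derivT in auto)
    then show "T y - T x = integral {x..y} (\<lambda>x. dirac_matrix q\<^sub>t \<xi> x ** T x)"
      by (simp add: integral_unique)
  qed
  then show "dirac_solution q\<^sub>t \<xi> T"
    unfolding dirac_solution_def by (intro exI[of _ "\<lambda>x. dirac_matrix q\<^sub>t \<xi> x ** T x"])
      (simp add: dirac_op_eq_iff)
next
  assume "dirac_solution q\<^sub>t \<xi> T"
  then obtain T' where T': "loc_abs_cont_deriv T T'"
    and ae: "AE x in lebesgue. T' x = dirac_matrix q\<^sub>t \<xi> x ** T x"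
    unfolding dirac_solution_def dirac_op_eq_iff by blast
  let ?G = "\<lambda>x. dirac_matrix q\<^sub>t \<xi> x ** T x"
  have int: "T' integrable_on {a..b}" and eq: "a \<le> b \<Longrightarrow> T b = T a + integral {a..b} T'" for a b
    using T' unfolding loc_abs_cont_deriv_def
    by (cases "a \<le> b"; auto simp: set_lebesgue_integral_eq_integral algebra_simps)+
  have cont: "continuous_on UNIV T"
  proof -
    have "isCont T x" for x
    proof -
      have "continuous_on {x - 1..x + 1} (\<lambda>y. T (x - 1) + integral {x - 1..y} T')"
        by (intro continuous_intros indefinite_integral_continuous_1 int)
      then have "continuous_on {x - 1..x + 1} T"
        by (rule continuous_on_eq) (simp add: eq[symmetric])
      then show ?thesis by (rule continuous_on_interior) simp
    qed
    then show ?thesis by (simp add: continuous_at_imp_continuous_on)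
  qed
  \<comment> \<open>The given derivative \<open>T'\<close> is exchanged, off a null set, for the
    explicit right-hand side, which can be evaluated pointwise.\<close>
  have eqG: "T b = T a + integral {a..b} ?G" if "a \<le> b" for a b
  proof -
    from ae obtain N where "N \<in> null_sets lebesgue" and N: "{x. T' x \<noteq> ?G x} \<subseteq> N"
      by (auto simp: eventually_ae_filter)
    then have neg: "negligible N" by (simp add: negligible_iff_null_sets)
    have "integral {a..b} ?G = integral {a..b} T'"
      by (rule integral_spike[OF neg]) (use N in auto)
    then show ?thesis using eq[OF that] by simp
  qed
  have intG: "?G integrable_on {a..b}" for a b
    using dirac_matrix_integrable[OF cont] by (rule set_lebesgue_integral_eq_integral(1))
  have deriv: "(T has_vector_derivative ?G x) (at x)" if x: "x \<notin> {\<alpha>, \<beta>}" for x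
  proof -
    have "((\<lambda>u. integral {x - 1..u} ?G) has_vector_derivative ?G x) (at x within ({x - 1..x + 1} - {}))"
      by (rule integral_has_vector_derivative_continuous_at[OF intG])
         (use dirac_matrix_continuous_at[OF cont x] in \<open>auto intro: continuous_at_imp_continuous_at_within\<close>)
    then have "((\<lambda>u. integral {x - 1..u} ?G) has_vector_derivative ?G x) (at x)"
      by (simp add: at_within_Icc_at)
    then have "((\<lambda>u. T (x - 1) + integral {x - 1..u} ?G) has_vector_derivative 0 + ?G x) (at x)"
      by (intro has_vector_derivative_add has_vector_derivative_const)
    then have "((\<lambda>u. T (x - 1) + integral {x - 1..u} ?G) has_vector_derivative ?G x) (at x)" by simp
    then show ?thesis
      by (rule has_vector_derivative_transform_within_open[of _ _ _ "{x - 1<..<x + 1}"]) (auto simp: eqG[symmetric])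
  qed
  have "\<Psi> \<xi> x ** T x = \<Psi> \<xi> 0 ** T 0" for x
  proof (rule has_derivative_zero_unique_strong_convex[of UNIV "{\<alpha>, \<beta>}" "\<lambda>x. \<Psi> \<xi> x ** T x"])
    show "continuous_on UNIV (\<lambda>x. \<Psi> \<xi> x ** T x)"
      by (intro continuous_on_matrix2_mult continuous_\<Psi> cont)
    fix x assume "x \<in> UNIV - {\<alpha>, \<beta>}"
    then have x: "x \<notin> {\<alpha>, \<beta>}" by auto
    have "((\<lambda>x. \<Psi> \<xi> x ** T x) has_vector_derivative
        - (\<Psi> \<xi> x ** dirac_matrix q\<^sub>t \<xi> x) ** T x + \<Psi> \<xi> x ** ?G x) (at x)"
      by (rule has_vector_derivative_matrix2_mult[OF deriv_\<Phi>\<Psi>(2)[OF x] deriv[OF x]])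
    also have "- (\<Psi> \<xi> x ** dirac_matrix q\<^sub>t \<xi> x) ** T x + \<Psi> \<xi> x ** ?G x = 0"
      by (simp add: matrix2_eq_iff matrix2_mult_nth algebra_simps)
    finally show "((\<lambda>x. \<Psi> \<xi> x ** T x) has_derivative (\<lambda>h. 0)) (at x within UNIV)"
      by (simp add: has_vector_derivative_def)
  qed auto
  then have "T x = \<Phi> \<xi> x ** (\<Psi> \<xi> 0 ** T 0)" for x
    by (metis \<Phi>_\<Psi> matrix_mul_assoc matrix_mul_lid)
  then show "\<exists>K. T = (\<lambda>x. \<Phi> \<xi> x ** K)" by blast
qed

definition M\<^sub>t :: "real \<Rightarrow> complex^2^2" where
  "M\<^sub>t \<xi> = mat2 (A\<^sub>t \<xi> \<beta>) (cnj (B\<^sub>t \<xi> \<beta>)) (B\<^sub>t \<xi> \<beta>) (cnj (A\<^sub>t \<xi> \<beta>))"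

definition M\<^sub>i :: "real \<Rightarrow> complex^2^2" where
  "M\<^sub>i \<xi> = mat2 (cnj (A\<^sub>t \<xi> \<beta>)) (- cnj (B\<^sub>t \<xi> \<beta>)) (- B\<^sub>t \<xi> \<beta>) (A\<^sub>t \<xi> \<beta>)"

lemma M_inverse: "M\<^sub>i \<xi> ** M\<^sub>t \<xi> = mat 1" "M\<^sub>t \<xi> ** M\<^sub>i \<xi> = mat 1"
  unfolding M\<^sub>t_def M\<^sub>i_def by (rule mat2_det_inverse; rule det_AB\<^sub>t)+

lemma \<Phi>_left: "x \<le> \<alpha> \<Longrightarrow> \<Phi> \<xi> x = free_solution x \<xi>"
  by (simp add: \<Phi>_def A\<^sub>t_def B\<^sub>t_def clip(2) AC_start flip: mat2_one)

lemma \<Phi>_right: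
  assumes "x \<ge> \<beta>"
  shows "\<Phi> \<xi> x = free_solution x \<xi> ** M\<^sub>t \<xi>"
  using clip(3)[OF assms] clip(3)[OF order_refl] by (simp add: \<Phi>_def M\<^sub>t_def A\<^sub>t_def B\<^sub>t_def)

text \<open>A solution is \<Phi> K, and left of the support \<Phi> is the free solution E. So E (K -
  1) tends to 0, which forces K = 1. To the right \<Phi> equals \<open>E M\<^sub>t\<close>, and the
  same argument gives \<open>K = M\<^sub>i\<close> for the other Jost solution.\<close>

lemma jost_minus_iff: "jost_minus q\<^sub>t \<xi> T \<longleftrightarrow> T = \<Phi> \<xi>"
proof
  assume "jost_minus q\<^sub>t \<xi> T"
  then obtain K where T: "T = (\<lambda>x. \<Phi> \<xi> x ** K)" and lim: "((\<lambda>x. T x - free_solution x \<xi>) \<longlongrightarrow> 0) at_bot"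
    unfolding jost_minus_def dirac_solution_iff by blast
  have "\<forall>\<^sub>F x in at_bot. T x - free_solution x \<xi> = free_solution x \<xi> ** (K - mat 1)"
    using eventually_le_at_bot[of \<alpha>] by eventually_elim (simp add: T \<Phi>_left matrix2_diff_distrib)
  then have "((\<lambda>x. free_solution x \<xi> ** (K - mat 1)) \<longlongrightarrow> 0) at_bot"
    using lim by (simp add: tendsto_cong)
  then have "K - mat 1 = 0" by (rule free_solution_mult_tendsto_0) simp
  then show "T = \<Phi> \<xi>" by (simp add: T)
next
  assume T: "T = \<Phi> \<xi>"
  have "\<forall>\<^sub>F x in at_bot. T x - free_solution x \<xi> = 0"
    using eventually_le_at_bot[of \<alpha>] by eventually_elim (simp add: T \<Phi>_left)
  then have "((\<lambda>x. T x - free_solution x \<xi>) \<longlongrightarrow> 0) at_bot" by (rule tendsto_eventually)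
  moreover have "dirac_solution q\<^sub>t \<xi> T"
    unfolding dirac_solution_iff T by (rule exI[of _ "mat 1"]) simp
  ultimately show "jost_minus q\<^sub>t \<xi> T" by (simp add: jost_minus_def)
qed

lemma jost_plus_iff: "jost_plus q\<^sub>t \<xi> T \<longleftrightarrow> T = (\<lambda>x. \<Phi> \<xi> x ** M\<^sub>i \<xi>)"
proof
  assume "jost_plus q\<^sub>t \<xi> T"
  then obtain K where T: "T = (\<lambda>x. \<Phi> \<xi> x ** K)" and lim: "((\<lambda>x. T x - free_solution x \<xi>) \<longlongrightarrow> 0) at_top"
    unfolding jost_plus_def dirac_solution_iff by blast
  have "\<forall>\<^sub>F x in at_top. T x - free_solution x \<xi> = free_solution x \<xi> ** (M\<^sub>t \<xi> ** K - mat 1)"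
    using eventually_ge_at_top[of \<beta>]
    by eventually_elim (simp add: T \<Phi>_right matrix2_diff_distrib matrix_mul_assoc)
  then have "((\<lambda>x. free_solution x \<xi> ** (M\<^sub>t \<xi> ** K - mat 1)) \<longlongrightarrow> 0) at_top"
    using lim by (simp add: tendsto_cong)
  then have "M\<^sub>t \<xi> ** K - mat 1 = 0" by (rule free_solution_mult_tendsto_0) simp
  then have "M\<^sub>t \<xi> ** K = mat 1" by simp
  then have "K = M\<^sub>i \<xi>" by (metis M_inverse(1) matrix_mul_assoc matrix_mul_lid matrix_mul_rid)
  then show "T = (\<lambda>x. \<Phi> \<xi> x ** M\<^sub>i \<xi>)" by (simp add: T)
next
  assume T: "T = (\<lambda>x. \<Phi> \<xi> x ** M\<^sub>i \<xi>)"
  have "\<forall>\<^sub>F x in at_top. T x - free_solution x \<xi> = 0"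
    using eventually_ge_at_top[of \<beta>]
    by eventually_elim (simp add: T \<Phi>_right M_inverse flip: matrix_mul_assoc)
  then have "((\<lambda>x. T x - free_solution x \<xi>) \<longlongrightarrow> 0) at_top" by (rule tendsto_eventually)
  moreover have "dirac_solution q\<^sub>t \<xi> T"
    unfolding dirac_solution_iff T by blast
  ultimately show "jost_plus q\<^sub>t \<xi> T" by (simp add: jost_plus_def)
qed

text \<open>The definite description needs existence and uniqueness; as each Jost solution is a
  single explicit function, uniqueness reduces to cancelling the invertible \<Phi> at one
  point.\<close>

lemma scattering_matrix_truncation: "scattering_matrix q\<^sub>t \<xi> = M\<^sub>t \<xi>"
  unfolding scattering_matrix_def jost_minus_iff jost_plus_iff
proof (rule the_equality)
  show "\<exists>Tp Tm. Tp = (\<lambda>x. \<Phi> \<xi> x ** M\<^sub>i \<xi>) \<and> Tm = \<Phi> \<xi> \<and> (\<forall>x. Tm x = Tp x ** M\<^sub>t \<xi>)"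
    by (simp add: M_inverse flip: matrix_mul_assoc)
  fix M assume "\<exists>Tp Tm. Tp = (\<lambda>x. \<Phi> \<xi> x ** M\<^sub>i \<xi>) \<and> Tm = \<Phi> \<xi> \<and> (\<forall>x. Tm x = Tp x ** M)"
  then have "\<Phi> \<xi> 0 = \<Phi> \<xi> 0 ** (M\<^sub>i \<xi> ** M)" by (simp add: matrix_mul_assoc)
  then have "M\<^sub>i \<xi> ** M = mat 1" by (metis \<Psi>_\<Phi> matrix_mul_assoc matrix_mul_lid)
  then show "M = M\<^sub>t \<xi>" by (metis M_inverse(2) matrix_mul_assoc matrix_mul_lid matrix_mul_rid)
qed

lemma coeff_a_truncation: "coeff_a \<xi> q\<^sub>t = A (of_real \<xi>) \<beta>"
  by (simp add: coeff_a_def scattering_matrix_truncation M\<^sub>t_def A\<^sub>t_def clip(3))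

section \<open>Identification of \<open>arg_a\<close> with the imaginary part of
  \<open>F\<close>\<close>

lemma ln_norm_coeff_a: "ln (norm (coeff_a s q\<^sub>t)) = Re (F (of_real s) \<beta>)"
  using exp_F[of \<beta> "of_real s"] less
  by (simp add: coeff_a_truncation flip: norm_exp_eq_Re) (metis ln_exp norm_exp_eq_Re)

text \<open>From exp (2 Re F) = |A|^2 = 1 + |C|^2 and 1 + x <= exp x follows 0 <= 2 Re F <= |C|^2,
  and the decay of \<open>C\<close> makes this O(1/s^2).\<close>

lemma integrable_Re_F: "integrable lebesgue (\<lambda>s. Re (F (of_real s) \<beta>))"
proof -
  obtain K where K: "\<And>k. Im k = 0 \<Longrightarrow> norm k * norm (C k \<beta>) \<le> K" "K \<ge> 0" by (rule C_decay) blast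
  \<comment> \<open>The first summand bounds Re F, the second bounds s^2 Re F; together they bound
    (1 + s^2) Re F.\<close>
  let ?D = "qmax * (\<beta> - \<alpha>) + K\<^sup>2 / 2"
  have b: "\<beta> \<in> {\<alpha>..\<beta>}" using less by auto
  have bound: "\<bar>Re (F (of_real s) \<beta>)\<bar> \<le> ?D * (1 / (1 + s\<^sup>2))" for s
  proof -
    let ?k = "of_real s :: complex"
    let ?x = "Re (F ?k \<beta>)"
    have nA: "norm (A ?k \<beta>) = exp ?x"
      using exp_F[OF b, of ?k] by (metis Im_complex_of_real norm_exp_eq_Re order_refl)
    have "1 + 2 * ?x \<le> exp (2 * ?x)" by (rule exp_ge_add_one_self)
    also have "\<dots> = (norm (A ?k \<beta>))\<^sup>2"
      by (simp add: nA exp_double)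
    also have eq: "\<dots> = 1 + (norm (C ?k \<beta>))\<^sup>2" by (rule energy_eq[OF b]) simp
    finally have x1: "2 * ?x \<le> (norm (C ?k \<beta>))\<^sup>2" by simp
    have "1 \<le> (norm (A ?k \<beta>))\<^sup>2" unfolding eq by simp
    then have x0: "0 \<le> ?x" by (simp add: nA flip: exp_double)
    have "(norm ?k * norm (C ?k \<beta>))\<^sup>2 \<le> K\<^sup>2"
      by (rule power_mono) (use K(1)[of ?k] in auto)
    then have "s\<^sup>2 * (norm (C ?k \<beta>))\<^sup>2 \<le> K\<^sup>2" by (simp add: power_mult_distrib)
    moreover have "s\<^sup>2 * (2 * ?x) \<le> s\<^sup>2 * (norm (C ?k \<beta>))\<^sup>2"
      using x1 by (rule mult_left_mono) simp
    ultimately have "s\<^sup>2 * ?x \<le> K\<^sup>2 / 2" by simp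
    moreover have "?x \<le> qmax * (\<beta> - \<alpha>)"
      using norm_F_le[OF b, of ?k] complex_Re_le_cmod[of "F ?k \<beta>"] by simp
    ultimately have "(1 + s\<^sup>2) * ?x \<le> ?D" by (simp add: algebra_simps)
    moreover have "1 + s\<^sup>2 > 0" by (simp add: add_pos_nonneg)
    ultimately show ?thesis using x0 by (simp add: field_simps)
  qed
  have "continuous_on UNIV (\<lambda>s. Re (F (of_real s) \<beta>))"
    by (intro continuous_intros continuous_on_compose2[OF continuous_F]) auto
  then have meas: "(\<lambda>s. Re (F (of_real s) \<beta>)) \<in> borel_measurable lebesgue"
    by (intro measurable_completion) (simp add: borel_measurable_continuous_onI)
  have major: "integrable lebesgue (\<lambda>s. ?D * (1 / (1 + s\<^sup>2)))"
    by (rule integrable_mult_right[OF integrable_inverse_1_plus_square])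
  show ?thesis
  proof (rule Bochner_Integration.integrable_bound[OF major meas], rule AE_I2)
    show "norm (Re (F (of_real s) \<beta>)) \<le> norm (?D * (1 / (1 + s\<^sup>2)))" for s
      using order_trans[OF bound[of s] abs_ge_self] by (simp only: real_norm_def)
  qed
qed

text \<open>Here the two branches meet: the logarithm continued in \<open>t\<close> is determined by
  its real part on the line because it is holomorphic and decays in \<open>k\<close>.\<close>

lemma log_a_truncation:
  assumes "Im k > 0"
  shows "log_a k q\<^sub>t = F k \<beta>"
proof -
  obtain K where K: "\<And>k. Im k \<ge> 0 \<Longrightarrow> norm k * norm (F k \<beta>) \<le> K" by (rule F_decay) blast
  show ?thesis
    unfolding log_a_def ln_norm_coeff_a
    by (rule half_plane_outer_representation[OF continuous_F holomorphic_F K integrable_Re_F assms])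
qed

lemma arg_a_truncation: "arg_a \<xi> q\<^sub>t = Im (F (of_real \<xi>) \<beta>)"
  unfolding arg_a_def
proof (rule tendsto_Lim)
  let ?H = "{k. Im k > 0}"
  \<comment> \<open>\<open>Lim\<close> has a determined value only along a nontrivial
    filter.\<close>
  have "of_real \<xi> islimpt ?H"
    unfolding islimpt_approachable
  proof (intro allI impI)
    fix e :: real assume "e > 0"
    then show "\<exists>k\<in>?H. k \<noteq> of_real \<xi> \<and> dist k (of_real \<xi>) < e"
      by (intro bexI[of _ "Complex \<xi> (e / 2)"]) (auto simp: complex_eq_iff dist_norm cmod_def)
  qed
  then show "\<not> trivial_limit (at (of_real \<xi>) within ?H)" by (simp add: trivial_limit_within)
  have "((\<lambda>k. F k \<beta>) \<longlongrightarrow> F (of_real \<xi>) \<beta>) (at (of_real \<xi>) within {k. Im k \<ge> 0})"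
    using continuous_F by (simp add: continuous_on_def)
  then have "((\<lambda>k. F k \<beta>) \<longlongrightarrow> F (of_real \<xi>) \<beta>) (at (of_real \<xi>) within ?H)"
    by (rule tendsto_within_subset) auto
  then have "((\<lambda>k. Im (F k \<beta>)) \<longlongrightarrow> Im (F (of_real \<xi>) \<beta>)) (at (of_real \<xi>) within ?H)"
    by (rule tendsto_Im)
  moreover have "\<forall>\<^sub>F k in at (of_real \<xi>) within ?H. Im (log_a k q\<^sub>t) = Im (F k \<beta>)"
    by (simp add: eventually_at_filter log_a_truncation)
  ultimately show "((\<lambda>k. Im (log_a k q\<^sub>t)) \<longlongrightarrow> Im (F (of_real \<xi>) \<beta>)) (at (of_real \<xi>) within ?H)"
    by (simp add: tendsto_cong)
qed

end

section \<open>Phase of a truncated chirp\<close>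

text \<open>The last assumption puts \<open>\<beta>\<close> where the local frequency
  \<open>(t - \<alpha>) / S\<close> is still \<open>4 * h\<close> short of \<open>\<xi>\<close>;
  together with \<open>\<alpha> < \<beta>\<close> it forces \<open>4 * h < \<xi>\<close>.\<close>

locale chirp = dirac_potential +
  fixes h S \<xi> :: real
  assumes h: "h > 0" and S: "S > 0"
    and q'_eq: "\<And>t. q' t = \<i> * of_real ((t - \<alpha>) / S) * q t"
    and norm_q: "\<And>t. norm (q t) = h"
    and \<beta>_eq: "\<beta> = \<alpha> + S * (\<xi> - 4 * h)"
begin

definition \<Delta> :: "real \<Rightarrow> real" where "\<Delta> t = \<xi> - (t - \<alpha>) / S"

lemma \<Delta>_ge: "t \<le> \<beta> \<Longrightarrow> \<Delta> t \<ge> 4 * h"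
  using S by (simp add: \<Delta>_def \<beta>_eq field_simps)

lemma \<Delta>_pos: "t \<le> \<beta> \<Longrightarrow> \<Delta> t > 0"
  using \<Delta>_ge[of t] h by linarith

lemma \<Delta>_ends: "\<Delta> \<alpha> = \<xi>" "\<Delta> \<beta> = 4 * h"
  using S by (auto simp: \<Delta>_def \<beta>_eq)

lemma deriv_\<Delta>: "(\<Delta> has_vector_derivative - 1 / S) (at t within X)"
  unfolding \<Delta>_def[abs_def] has_real_derivative_iff_has_vector_derivative[symmetric]
  using S by (auto intro!: derivative_eq_intros)

lemma cnj_q_mult_q: "cnj (q t) * q t = of_real (h\<^sup>2)" "q t * cnj (q t) = of_real (h\<^sup>2)"
  using norm_q[of t] complex_norm_square[of "q t"] by (simp_all add: mult.commute)

text \<open>Write q = h exp(i \<phi>) and D = C exp(-i \<phi>). Then A' = h D and D' = i \<Delta> D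
  + h A, and for constant \<Delta> the quadratic form \<Delta> |D|^2 + 2 h Im (A cnj D) is
  conserved. For moving \<Delta> its derivative is just \<Delta>' |D|^2 = - |C|^2 / S. The statement
  is about the negative of this form in the original variables.\<close>

lemma deriv_adiabatic_energy:
  assumes "s \<in> {\<alpha>..t}" "t \<le> \<beta>"
  shows "((\<lambda>s. - (\<Delta> s * Re (C \<xi> s * cnj (C \<xi> s)) + 2 * Im (q s * (A \<xi> s * cnj (C \<xi> s)))))
    has_vector_derivative (norm (C \<xi> s))\<^sup>2 / S) (at s within {\<alpha>..t})"
proof -
  note d = deriv_AC_within[OF assms, of \<xi>]
  let ?f = "(s - \<alpha>) / S"
  let ?A = "A \<xi> s" and ?C = "C \<xi> s"
  let ?A' = "cnj (q s) * ?C" and ?C' = "\<i> * of_real \<xi> * ?C + q s * ?A"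
  let ?d = "- ((\<Delta> s * Re (?C * cnj ?C' + ?C' * cnj ?C) + - 1 / S * Re (?C * cnj ?C)) +
      2 * Im (q s * (?A * cnj ?C' + ?A' * cnj ?C) + \<i> * of_real ?f * q s * (?A * cnj ?C)))"
  have "((\<lambda>s. - (\<Delta> s * Re (C \<xi> s * cnj (C \<xi> s)) + 2 * Im (q s * (A \<xi> s * cnj (C \<xi> s)))))
    has_vector_derivative ?d) (at s within {\<alpha>..t})"
    by (intro has_vector_derivative_minus has_vector_derivative_add has_vector_derivative_mult deriv_\<Delta>
        has_vector_derivative_Re has_vector_derivative_Im has_vector_derivative_mult_right has_vector_derivative_cnj d
        has_vector_derivative_at_within[OF deriv_q, unfolded q'_eq])
  also have "?d = (norm ?C)\<^sup>2 / S"
  proof -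
    have 1: "q s * (?A * cnj ?C' + ?A' * cnj ?C) = - (\<i> * of_real \<xi> * (q s * ?A * cnj ?C)) +
        (q s * cnj (q s)) * (?A * cnj ?A) + (q s * cnj (q s)) * (?C * cnj ?C)"
      by (simp add: algebra_simps)
    have 2: "?C * cnj ?C' + ?C' * cnj ?C = of_real (2 * Re (q s * ?A * cnj ?C))"
      using complex_add_cnj[of "q s * ?A * cnj ?C"] by (simp add: algebra_simps)
    have 3: "Im (q s * (?A * cnj ?C' + ?A' * cnj ?C)) = - \<xi> * Re (q s * ?A * cnj ?C)"
      unfolding 1 cnj_q_mult_q by (simp flip: complex_norm_square)
    have 4: "Im (\<i> * of_real ?f * q s * (?A * cnj ?C)) = ?f * Re (q s * ?A * cnj ?C)"
      by (simp add: mult.assoc)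
    have 5: "Re (?C * cnj ?C) = (norm ?C)\<^sup>2" by (simp flip: complex_norm_square)
    show ?thesis
      unfolding 2 5 plus_complex.simps 3 4 Re_complex_of_real by (simp add: \<Delta>_def algebra_simps)
  qed
  finally show ?thesis .
qed

text \<open>The quantity differentiated above is an adiabatic invariant up to a monotone error:
  its decrease as the local frequency of \<open>q\<close> approaches \<open>\<xi>\<close> keeps the reflection coefficient small.\<close>

lemma norm_rho_le_half:
  assumes t: "t \<in> {\<alpha>..\<beta>}"
  shows "norm (\<rho> \<xi> t) \<le> 1 / 2"
proof -
  let ?A = "A \<xi> t" and ?C = "C \<xi> t"
  have "- (\<Delta> \<alpha> * Re (C \<xi> \<alpha> * cnj (C \<xi> \<alpha>)) + 2 * Im (q \<alpha> * (A \<xi> \<alpha> * cnj (C \<xi> \<alpha>))))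
      \<le> - (\<Delta> t * Re (?C * cnj ?C) + 2 * Im (q t * (?A * cnj ?C)))"
    by (rule has_vector_derivative_nonneg_le[OF _ deriv_adiabatic_energy]) (use t S in auto)
  then have "\<Delta> t * (norm ?C)\<^sup>2 \<le> - 2 * Im (q t * (?A * cnj ?C))"
    by (simp add: AC_start flip: complex_norm_square)
  also have "\<dots> \<le> 2 * norm (q t * (?A * cnj ?C))"
    using abs_Im_le_cmod[of "q t * (?A * cnj ?C)"] by linarith
  also have "\<dots> = 2 * h * norm ?A * norm ?C" by (simp add: norm_mult norm_q)
  finally have 1: "\<Delta> t * (norm ?C)\<^sup>2 \<le> 2 * h * norm ?A * norm ?C" .
  \<comment> \<open>Comparing the coefficients 4h and 2h yields the ratio 1/2; this fixes the
    distance at which the chirp is cut.\<close>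
  have "4 * h * (norm ?C)\<^sup>2 \<le> \<Delta> t * (norm ?C)\<^sup>2"
    using \<Delta>_ge[of t] t by (intro mult_right_mono) auto
  with 1 have "2 * h * norm ?C * (2 * norm ?C) \<le> 2 * h * norm ?C * norm ?A"
    by (simp add: power2_eq_square mult_ac)
  then have "2 * norm ?C \<le> norm ?A"
    using h by (cases "?C = 0") auto
  then show ?thesis
    using A_nonzero[OF t, of \<xi>] by (simp add: \<rho>_def norm_divide field_simps)
qed

text \<open>With w = cnj q * \<rho> = F', the real part of w' = i \<Delta> w + h^2 - w^2 gives Im F'
  = (h^2 - Re w^2 - Re w') / \<Delta>. The first two terms are at least (3/4) h^2 / \<Delta>, whose
  integral is the logarithm; the term with w' is integrated by parts.\<close>

lemma arg_lower_bound: "Im (F \<xi> \<beta>) \<ge> 3 / 4 * h\<^sup>2 * S * ln (\<xi> / (4 * h)) - 1 / 2"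
proof -
  define w where "w = (\<lambda>t. cnj (q t) * \<rho> \<xi> t)"
  \<comment> \<open>The middle term absorbs Re w' / \<Delta>. Adding \<open>h\<close> to Re w makes
    the remainder (Re w + h) / (S \<Delta>^2) nonnegative, so \<open>y\<close> is monotone and no
    oscillatory integral has to be estimated.\<close>
  define y where "y = (\<lambda>t. Im (F \<xi> t) + (Re (w t) + h) * inverse (\<Delta> t) + 3 / 4 * h\<^sup>2 * S * ln (\<Delta> t))"
  have nw: "norm (w t) \<le> h / 2" if "t \<in> {\<alpha>..\<beta>}" for t
    using mult_left_mono[OF norm_rho_le_half[OF that], of h] h by (simp add: w_def norm_mult norm_q)
  have dw: "(w has_vector_derivative \<i> * of_real (\<Delta> t) * w t + of_real (h\<^sup>2) - (w t)\<^sup>2) (at t within {\<alpha>..\<beta>})"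
    if t: "t \<in> {\<alpha>..\<beta>}" for t
  proof -
    have \<Delta>: "of_real (\<Delta> t) = (of_real \<xi> - of_real ((t - \<alpha>) / S) :: complex)" by (simp add: \<Delta>_def)
    have "(w has_vector_derivative cnj (q t) * (\<i> * of_real \<xi> * \<rho> \<xi> t + q t - cnj (q t) * (\<rho> \<xi> t)\<^sup>2)
        + cnj (\<i> * of_real ((t - \<alpha>) / S) * q t) * \<rho> \<xi> t) (at t within {\<alpha>..\<beta>})"
      unfolding w_def using t
      by (intro has_vector_derivative_mult has_vector_derivative_cnj deriv_rho
          has_vector_derivative_at_within[OF deriv_q, unfolded q'_eq]) auto
    also have "cnj (q t) * (\<i> * of_real \<xi> * \<rho> \<xi> t + q t - cnj (q t) * (\<rho> \<xi> t)\<^sup>2)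
        + cnj (\<i> * of_real ((t - \<alpha>) / S) * q t) * \<rho> \<xi> t
        = \<i> * of_real (\<Delta> t) * w t + cnj (q t) * q t - (w t)\<^sup>2"
      unfolding w_def \<Delta>
      by (simp add: algebra_simps power2_eq_square del: of_real_divide of_real_diff)
    finally show ?thesis unfolding cnj_q_mult_q .
  qed
  define d where "d = (\<lambda>t. Im (w t) + ((Re (w t) + h) * (- (inverse (\<Delta> t) * (- 1 / S) * inverse (\<Delta> t))) +
        (Re (\<i> * of_real (\<Delta> t) * w t + of_real (h\<^sup>2) - (w t)\<^sup>2) + 0) * inverse (\<Delta> t)) +
        3 / 4 * h\<^sup>2 * S * (inverse (\<Delta> t) * (- 1 / S)))"
  have "y \<alpha> \<le> y \<beta>"
  proof (rule has_vector_derivative_nonneg_le[where f = y and f' = d and a = \<alpha> and b = \<beta>])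
    fix t assume t: "t \<in> {\<alpha>..\<beta>}"
    let ?D = "\<Delta> t" and ?w = "w t"
    have D: "?D > 0" using \<Delta>_pos t by auto
    have dinv: "((\<lambda>t. inverse (\<Delta> t)) has_vector_derivative - (inverse ?D * (- 1 / S) * inverse ?D)) (at t within {\<alpha>..\<beta>})"
      using D deriv_\<Delta>[of t "{\<alpha>..\<beta>}"] unfolding has_real_derivative_iff_has_vector_derivative[symmetric]
      by (intro DERIV_inverse') auto
    have dln: "((\<lambda>t. ln (\<Delta> t)) has_vector_derivative inverse ?D * (- 1 / S)) (at t within {\<alpha>..\<beta>})"
      using D deriv_\<Delta>[of t "{\<alpha>..\<beta>}"] unfolding has_real_derivative_iff_has_vector_derivative[symmetric]
      by (auto intro!: derivative_eq_intros simp: divide_inverse)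
    have dF: "(F \<xi> has_vector_derivative w t) (at t within {\<alpha>..\<beta>})"
      unfolding w_def by (rule deriv_F[OF t]) simp
    show "(y has_vector_derivative d t) (at t within {\<alpha>..\<beta>})"
      unfolding y_def d_def
      by (intro has_vector_derivative_add has_vector_derivative_Im has_vector_derivative_Re has_vector_derivative_mult
          has_vector_derivative_mult_right has_vector_derivative_const dF dw[OF t] dinv dln)
    \<comment> \<open>With |w| <= h/2 the quadratic term takes at most a quarter of h^2; hence the
      factor 3/4.\<close>
    have "Re (?w\<^sup>2) \<le> (norm ?w)\<^sup>2"
      using complex_Re_le_cmod[of "?w\<^sup>2"] by (simp add: norm_power)
    also have "\<dots> \<le> (h / 2)\<^sup>2" using nw[OF t] by (intro power_mono) auto
    finally have 1: "0 \<le> h\<^sup>2 / 4 - Re (?w\<^sup>2)" by (simp add: power_divide)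
    have 2: "0 \<le> Re ?w + h"
      using abs_Re_le_cmod[of ?w] nw[OF t] h by linarith
    have d_eq: "d t = (h\<^sup>2 / 4 - Re (?w\<^sup>2)) * inverse ?D + (Re ?w + h) * (1 / S * (inverse ?D)\<^sup>2)"
    proof -
      have "d t = Im ?w + (Re ?w + h) * (1 / S * (inverse ?D)\<^sup>2) +
          (h\<^sup>2 - Re (?w\<^sup>2) - ?D * Im ?w) * inverse ?D - 3 / 4 * h\<^sup>2 * (S * (1 / S)) * inverse ?D"
        unfolding d_def by (simp add: power2_eq_square algebra_simps)
      also have "\<dots> = Im ?w * (1 - ?D * inverse ?D) + (Re ?w + h) * (1 / S * (inverse ?D)\<^sup>2) +
          (h\<^sup>2 - 3 / 4 * h\<^sup>2 * (S * (1 / S)) - Re (?w\<^sup>2)) * inverse ?D"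
        by (simp add: algebra_simps)
      also have "\<dots> = (h\<^sup>2 / 4 - Re (?w\<^sup>2)) * inverse ?D + (Re ?w + h) * (1 / S * (inverse ?D)\<^sup>2)"
        using D S by simp
      finally show ?thesis .
    qed
    show "0 \<le> d t"
      unfolding d_eq using D S by (intro add_nonneg_nonneg[OF mult_nonneg_nonneg[OF 1] mult_nonneg_nonneg[OF 2]]) auto
  qed (use less in auto)
  moreover have "\<xi> > 0" using \<Delta>_pos[of \<alpha>] less \<Delta>_ends by auto
  moreover have "y \<alpha> = h / \<xi> + 3 / 4 * h\<^sup>2 * S * ln \<xi>"
  proof -
    have "F \<xi> \<alpha> = 0" "w \<alpha> = 0" by (simp_all add: F_def w_def \<rho>_def AC_start)
    then show ?thesis unfolding y_def \<Delta>_ends by (simp add: inverse_eq_divide)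
  qed
  \<comment> \<open>The boundary term is at most 2h / (4h), as Re w + h <= 2h and the final detuning
    is 4h. This is the constant subtracted in the conclusion.\<close>
  moreover have "y \<beta> \<le> Im (F \<xi> \<beta>) + 1 / 2 + 3 / 4 * h\<^sup>2 * S * ln (4 * h)"
  proof -
    have "Re (w \<beta>) \<le> h / 2" using nw[of \<beta>] less complex_Re_le_cmod[of "w \<beta>"] by auto
    then have "(Re (w \<beta>) + h) * inverse (4 * h) \<le> (2 * h) * inverse (4 * h)"
      using h by (intro mult_right_mono) auto
    also have "\<dots> = 1 / 2" using h by simp
    finally show ?thesis by (simp add: y_def \<Delta>_ends)
  qed
  moreover have "h / \<xi> > 0" using h \<open>\<xi> > 0\<close> by simp
  moreover have "3 / 4 * h\<^sup>2 * S * ln (\<xi> / (4 * h)) = 3 / 4 * h\<^sup>2 * S * ln \<xi> - 3 / 4 * h\<^sup>2 * S * ln (4 * h)"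
  proof -
    have "ln (\<xi> / (4 * h)) = ln \<xi> - ln (4 * h)" using h \<open>\<xi> > 0\<close> by (simp add: ln_div)
    then show ?thesis by (simp only: right_diff_distrib)
  qed
  ultimately show ?thesis by linarith
qed

end

section \<open>The chirps and the potential assembled from them\<close>

definition chirp_potential :: "real \<Rightarrow> real \<Rightarrow> real \<Rightarrow> real \<Rightarrow> complex" where
  "chirp_potential h S \<alpha> t = of_real h * exp (\<i> * of_real ((t - \<alpha>)\<^sup>2 / (2 * S)))"

lemma norm_chirp_potential: "norm (chirp_potential h S \<alpha> t) = \<bar>h\<bar>"
  by (simp add: chirp_potential_def norm_mult del: of_real_divide of_real_power)

lemma deriv_chirp_potential:
  "(chirp_potential h S \<alpha> has_vector_derivative \<i> * of_real ((t - \<alpha>) / S) * chirp_potential h S \<alpha> t) (at t)"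
proof -
  have "((\<lambda>t. (t - \<alpha>)\<^sup>2) has_real_derivative 2 * (t - \<alpha>)) (at t)"
    by (auto intro!: derivative_eq_intros)
  from DERIV_cdivide[OF this, of "2 * S"]
  have "((\<lambda>t. (t - \<alpha>)\<^sup>2 / (2 * S)) has_real_derivative (t - \<alpha>) / S) (at t)"
    by (subst (asm) mult_divide_mult_cancel_left) auto
  then have "((\<lambda>t. \<i> * complex_of_real ((t - \<alpha>)\<^sup>2 / (2 * S))) has_vector_derivative \<i> * of_real ((t - \<alpha>) / S)) (at t)"
    by (intro has_vector_derivative_mult_right has_vector_derivative_of_real)
  from has_vector_derivative_mult_right[OF has_vector_derivative_exp[OF this], of "of_real h"]
  show ?thesis
    unfolding chirp_potential_def[abs_def] by (simp add: mult_ac)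
qed

lemma continuous_chirp_potential: "continuous_on X (chirp_potential h S \<alpha>)"
  by (intro continuous_at_imp_continuous_on ballI has_vector_derivative_continuous[OF deriv_chirp_potential])

lemma arg_a_chirp:
  assumes h: "h > 0" and S: "S > 0" and \<xi>: "4 * h < \<xi>"
  shows "arg_a \<xi> (truncation (chirp_potential h S \<alpha>) \<alpha> (\<alpha> + S * (\<xi> - 4 * h)))
    \<ge> 3 / 4 * h\<^sup>2 * S * ln (\<xi> / (4 * h)) - 1 / 2"
proof -
  interpret chirp "chirp_potential h S \<alpha>" "\<lambda>t. \<i> * of_real ((t - \<alpha>) / S) * chirp_potential h S \<alpha> t"
    \<alpha> "\<alpha> + S * (\<xi> - 4 * h)" h S \<xi>
    using assms by unfold_locales
      (auto simp: norm_chirp_potential deriv_chirp_potential simp del: of_real_divide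
        intro!: continuous_intros continuous_chirp_potential)
  show ?thesis
    using arg_lower_bound unfolding arg_a_truncation .
qed

text \<open>For \<xi> >= 1/2, ln (\<xi> / (4h)) >= ln (1 / (8h)) = 2^(n+1) (n + 1). With h^2 S =
  2^-n the phase bound becomes (3/2) (n + 1) - 1/2 >= n. The divisor 8 makes this logarithm exact
  and also ensures 4h < 1/2 <= \<xi>.\<close>

definition block_height :: "nat \<Rightarrow> real" where
  "block_height n = exp (- (2 ^ Suc n * (real n + 1))) / 8"

definition block_length :: "nat \<Rightarrow> real" where
  "block_length n = (1 / 2) ^ n / (block_height n)\<^sup>2"

definition block_start :: "nat \<Rightarrow> real" where
  "block_start n = (\<Sum>i<n. block_length i)"

text \<open>Half-open, so that consecutive blocks share no endpoint and are disjoint.\<close>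

definition block :: "nat \<Rightarrow> real set" where
  "block n = {block_start n..<block_start (Suc n)}"

definition block_chirp :: "nat \<Rightarrow> real \<Rightarrow> complex" where
  "block_chirp n = chirp_potential (block_height n) (block_length n) (block_start n)"

text \<open>At each point at most one term is nonzero; the series form makes measurability immediate
  and gives the value 0 off the blocks.\<close>

definition bad_potential :: "real \<Rightarrow> complex" where
  "bad_potential x = (\<Sum>n. indicator (block n) x * block_chirp n x)"

lemma block_height_pos: "block_height n > 0" and block_height_less: "block_height n < 1 / 8"
  by (simp_all add: block_height_def)

lemma block_length_pos: "block_length n > 0"
  using block_height_pos[of n] by (simp add: block_length_def)

lemma block_energy: "(block_height n)\<^sup>2 * block_length n = (1 / 2) ^ n"
  using block_height_pos[of n] by (simp add: block_length_def)

lemma block_start_Suc: "block_start (Suc n) = block_start n + block_length n"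
  by (simp add: block_start_def)

lemma mono_block_start: "m \<le> n \<Longrightarrow> block_start m \<le> block_start n"
  unfolding block_start_def using block_length_pos less_imp_le by (intro sum_mono2) auto

lemma disjoint_block:
  assumes "x \<in> block m" "x \<in> block n"
  shows "m = n"
proof (rule ccontr)
  assume "m \<noteq> n"
  then consider "Suc m \<le> n" | "Suc n \<le> m" by linarith
  then show False
    by cases (use assms mono_block_start[of "Suc m" n] mono_block_start[of "Suc n" m] in \<open>auto simp: block_def\<close>)
qed

lemma sums_block:
  fixes f :: "nat \<Rightarrow> 'a::{real_normed_algebra_1}"
  assumes "x \<in> block n"
  shows "(\<lambda>i. indicator (block i) x * f i) sums f n"
proof -
  have "(\<lambda>i. indicator (block i) x * f i) = (\<lambda>i. if i = n then f n else 0)"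
    using assms disjoint_block by (auto simp: indicator_def fun_eq_iff)
  then show ?thesis using sums_single[of n "\<lambda>_. f n"] by simp
qed

lemma bad_potential_block: "x \<in> block n \<Longrightarrow> bad_potential x = block_chirp n x"
  unfolding bad_potential_def by (rule sums_unique[symmetric, OF sums_block])

text \<open>Disjointness removes all cross terms, so the L2 norm can be integrated term by term,
  block \<open>n\<close> contributing h^2 S = 2^-n.\<close>

lemma norm_bad_potential_sums:
  "(\<lambda>n. indicator (block n) x * (block_height n)\<^sup>2) sums (norm (bad_potential x))\<^sup>2"
proof (cases "\<exists>n. x \<in> block n")
  case True
  then obtain n where n: "x \<in> block n" by blast
  have "(norm (bad_potential x))\<^sup>2 = (block_height n)\<^sup>2"
    by (simp add: bad_potential_block[OF n] block_chirp_def norm_chirp_potential)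
  with sums_block[OF n, of "\<lambda>n. (block_height n)\<^sup>2"] show ?thesis by simp
next
  case False
  then show ?thesis by (simp add: bad_potential_def)
qed

lemma L2_bad_potential: "L2_real bad_potential"
  unfolding L2_real_def
proof
  have [measurable]: "block n \<in> sets borel" for n by (simp add: block_def)
  have [measurable]: "block_chirp n \<in> borel_measurable borel" for n
    unfolding block_chirp_def by (intro borel_measurable_continuous_onI continuous_chirp_potential)
  have "bad_potential \<in> borel_measurable borel"
    unfolding bad_potential_def[abs_def] by measurable
  then show "bad_potential \<in> borel_measurable lebesgue"
    by (intro measurable_completion) simp
  have "integrable lborel (\<lambda>x. \<Sum>n. indicator (block n) x * (block_height n)\<^sup>2)"
  proof (rule integrable_suminf)
    have bi: "has_bochner_integral lborel (\<lambda>x. indicator (block n) x * (block_height n)\<^sup>2) ((1 / 2) ^ n)" for n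
    proof -
      have "emeasure lborel (block n) = ennreal (block_length n)"
        using block_length_pos[of n] by (simp add: block_def block_start_Suc)
      then have "has_bochner_integral lborel (indicator (block n)) (block_length n)"
        using has_bochner_integral_real_indicator[of "block n" lborel] block_length_pos[of n]
        by (simp add: measure_def)
      then have "has_bochner_integral lborel (\<lambda>x. indicator (block n) x * (block_height n)\<^sup>2)
          (block_length n * (block_height n)\<^sup>2)"
        by (rule has_bochner_integral_mult_left)
      then show ?thesis
        using block_energy[of n] by (simp add: mult.commute)
    qed
    show "integrable lborel (\<lambda>x. indicator (block n) x * (block_height n)\<^sup>2)" for n
      using bi by (rule integrable.intros)
    show "AE x in lborel. summable (\<lambda>n. norm (indicator (block n) x * (block_height n)\<^sup>2))"
      using norm_bad_potential_sums by (auto simp: norm_mult intro: sums_summable)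
    have "(LINT x|lborel. norm (indicator (block n) x * (block_height n)\<^sup>2)) = (1 / 2) ^ n" for n
      using has_bochner_integral_integral_eq[OF bi[of n]] by (simp add: norm_mult abs_mult)
    then show "summable (\<lambda>n. LINT x|lborel. norm (indicator (block n) x * (block_height n)\<^sup>2))"
      by (simp add: summable_geometric)
  qed
  then have "integrable lborel (\<lambda>x. (norm (bad_potential x))\<^sup>2)"
    using sums_unique[OF norm_bad_potential_sums] by simp
  then show "integrable lebesgue (\<lambda>x. (norm (bad_potential x))\<^sup>2)"
    by (subst integrable_completion) auto
qed

text \<open>For each \<open>n\<close> the window opens exactly where block \<open>n\<close> starts,
  which discards all earlier chirps, and closes inside that block at a point depending on
  \<xi>.\<close>

lemma M_w_bad_potential:
  assumes \<xi>: "\<xi> \<in> {1/2..1}"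
  shows "M_w \<xi> bad_potential = \<infinity>"
  unfolding M_w_def
proof (rule SUP_PInfty)
  fix n :: nat
  let ?h = "block_height n" and ?S = "block_length n" and ?T1 = "block_start n"
  let ?T2 = "?T1 + ?S * (\<xi> - 4 * ?h)"
  have h: "4 * ?h < \<xi>" using block_height_less[of n] \<xi> by auto
  \<comment> \<open>Strictness, from \<xi> <= 1 and h > 0, matters: the window is closed, and the
    right end of the block already belongs to the next one.\<close>
  have "?S * (\<xi> - 4 * ?h) < ?S * 1"
    using block_length_pos[of n] block_height_pos[of n] \<xi> by (intro mult_strict_left_mono) auto
  then have "{?T1..?T2} \<subseteq> block n"
    by (auto simp: block_def block_start_Suc)
  then have trunc: "truncation bad_potential ?T1 ?T2 = truncation (block_chirp n) ?T1 ?T2"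
    using bad_potential_block by (auto simp: truncation_def indicator_def fun_eq_iff)
  have "2 ^ Suc n * (real n + 1) = ln (1 / (8 * ?h))"
    by (simp add: block_height_def ln_div)
  also have "\<dots> \<le> ln (\<xi> / (4 * ?h))"
    using block_height_pos[of n] \<xi> by (intro ln_mono) (auto simp: field_simps)
  finally have le: "3 / 4 * (1 / 2) ^ n * (2 ^ Suc n * (real n + 1)) \<le> 3 / 4 * (1 / 2) ^ n * ln (\<xi> / (4 * ?h))"
    by (intro mult_left_mono) auto
  have "real n \<le> 3 / 2 * (real n + 1) - 1 / 2" by (simp add: field_simps)
  also have "\<dots> = 3 / 4 * (1 / 2) ^ n * (2 ^ Suc n * (real n + 1)) - 1 / 2"
    by (simp add: power_one_over field_simps)
  also have "\<dots> \<le> 3 / 4 * (1 / 2) ^ n * ln (\<xi> / (4 * ?h)) - 1 / 2"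
    using le by (rule diff_right_mono)
  also have "\<dots> \<le> arg_a \<xi> (truncation bad_potential ?T1 ?T2)"
    using arg_a_chirp[OF block_height_pos[of n] block_length_pos[of n] h, of ?T1]
    unfolding trunc block_chirp_def mult.assoc[of "3 / 4" "?h\<^sup>2"] block_energy by simp
  finally have "ereal (real n) \<le> ereal \<bar>arg_a \<xi> (truncation bad_potential ?T1 ?T2)\<bar>" by simp
  moreover have "?T1 < ?T2" using block_length_pos[of n] h by simp
  ultimately show "\<exists>T\<in>{(T1, T2). T1 < T2}. ereal (real n) \<le> (case T of (T1, T2) \<Rightarrow> ereal \<bar>arg_a \<xi> (truncation bad_potential T1 T2)\<bar>)"
    by (intro bexI[of _ "(?T1, ?T2)"]) auto
qed

theorem theorem2p3:
  shows "\<exists>q :: real \<Rightarrow> complex. L2_real q \<and> (\<forall>\<xi> \<in> {1/2..1}. M_w \<xi> q = \<infinity>)"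
  using L2_bad_potential M_w_bad_potential by blast

end
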